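(* Consider the min-max problem (W-DHRAS with $p=1$) $$\min_{x\in\mathcal X,\ a\in\mathcal A}\ \sup_{\mathbb Q\in\mathcal F_1(\hat{\mathbb P}^R,\epsilon)}\mathbb E_{\mathbb Q}[f(x,a,\xi)].$$ This problem is equivalent to the following mixed-integer linear program, in the sense that the optimal values coincide and $(x,a)$ is optimal for W-DHRAS if and only if it can be completed to an optimal solution of the program: $$\min\ \epsilon\rho+\frac1R\sum_{r=1}^R\Big(\sum_{i=1}^N\psi^r_{i,0}+\sum_{j=1}^{N+2}\beta^r_j\Big)$$ over $x\in\mathcal X$, $a\in\mathcal A$, $\rho\ge0$, $\beta^r\in\mathbb R^{N+2}$, real variables $u^r,\nu^r$ and linearization variables $\tau,\psi^r,\phi^r,\sigma^r,\zeta^r$ ($r\in[R]$), subject to, for every $r\in[R]$: (1) $\beta^r_1\ge-a_1\pi_{1,1}+\sum_{i=1}^N\sigma^r_{0,i,1,1}$; (2) for all $v\in[2,N+2]_{\mathbb Z}$, with $m=\min(v,N+1)$: $\sum_{j=1}^v\beta^r_j\ge-a_1\pi_{1,v}+\sum_{j=2}^m(a_{j-1}-a_j)\pi_{j,v}+\sum_{i=1}^N\sigma^r_{0,i,1,v}+\sum_{j=2}^m\sum_{i=1}^N\sum_{i'\in[N]\setminus\{i\}}\phi^r_{i,i',j,v}+\sum_{j=2}^m\sum_{i=1}^N\zeta^r_{i,j,v}$; (3) for all $k\in[2,N+1]_{\mathbb Z}$, $v\in[k,N+2]_{\mathbb Z}$, with $m=\min(v,N+1)$: $\sum_{j=k}^v\beta^r_j\ge\sum_{j=k}^m(a_{j-1}-a_j)\pi_{j,v}+\sum_{j=k}^m\sum_{i=1}^N\zeta^r_{i,j,v}+\sum_{j=k}^m\sum_{i=1}^N\sum_{i'\in[N]\setminus\{i\}}\phi^r_{i,i',j,v}$;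 (4) $\beta^r_{N+2}\ge0$; (5) $u^r_{i,0}\ge\lambda\hat t^r_{i,0}$ and $u^r_{i,0}\ge\lambda\overline t_{i,0}-\rho(\overline t_{i,0}-\hat t^r_{i,0})$ for $i\in[N]$; (6) $u^r_{0,i,1,v}\ge(\pi_{1,v}+\lambda)\underline t_{0,i}-\rho(\hat t^r_{0,i}-\underline t_{0,i})$, $u^r_{0,i,1,v}\ge(\pi_{1,v}+\lambda)\hat t^r_{0,i}$, $u^r_{0,i,1,v}\ge(\pi_{1,v}+\lambda)\overline t_{0,i}-\rho(\overline t_{0,i}-\hat t^r_{0,i})$ for $i\in[N]$, $v\in[N+2]$; (7) $u^r_{i,i',j,v}\ge(\pi_{j,v}+\lambda)\underline t_{i,i'}-\rho(\hat t^r_{i,i'}-\underline t_{i,i'})$, $u^r_{i,i',j,v}\ge(\pi_{j,v}+\lambda)\hat t^r_{i,i'}$, $u^r_{i,i',j,v}\ge(\pi_{j,v}+\lambda)\overline t_{i,i'}-\rho(\overline t_{i,i'}-\hat t^r_{i,i'})$ for $i\in[N]$, $i'\in[N]\setminus\{i\}$, $j\in[2,N+1]_{\mathbb Z}$, $v\in[j,N+2]_{\mathbb Z}$; (8) $\nu^r_{i,j,v}\ge\pi_{j,v}\underline d_i-\rho(\hat d^r_i-\underline d_i)$, $\nu^r_{i,j,v}\ge\pi_{j,v}\hat d^r_i$, $\nu^r_{i,j,v}\ge\pi_{j,v}\overline d_i-\rho(\overline d_i-\hat d^r_i)$ for $i\in[N]$, $j\in[2,N+1]_{\mathbb Z}$,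 $v\in[j,N+2]_{\mathbb Z}$; (9) the McCormick inequalities listed in the context.
   Context: Notation: $[m]=\{1,\dots,m\}$, $[k,m]_{\mathbb Z}=\{k,k+1,\dots,m\}$. $N$ is a positive integer (number of customers; index $0$ is the depot), $L>0$, and $c^w_j,c^u_j$ ($j\in[N]$), $c^o$, $\lambda$ are nonnegative reals. $\mathcal X$ is the set of $x\in\{0,1\}^{N\times N}$ with $\sum_{i}x_{i,j}=1$ for all $j\in[N]$ and $\sum_jx_{i,j}=1$ for all $i\in[N]$. $\mathcal A$ is the set of $a\in\mathbb R^N$ with $0\le a_j\le L$ for all $j\in[N]$ and $a_j\ge a_{j-1}$ for $j\in[2,N]_{\mathbb Z}$. Conventions: $a_{N+1}=L$ and $x_{i,N+1}=0$ for all $i$. $\xi=(t,d)$ with $d=(d_i)_{i\in[N]}$ and $t=(t_{i,i'})_{i,i'\in\{0,\dots,N\},\,i\ne i'}$. $\mathcal S$ is the box of all $\xi\ge 0$ with $\underline d_i\le d_i\le\overline d_i$ and $\underline t_{i,i'}\le t_{i,i'}\le\overline t_{i,i'}$. $f(x,a,\xi)$ is the optimal value of the linear program: minimize $\sum_{j=1}^N(c^w_jw_j+c^u_ju_j)+c^ow_{N+1}+\lambda A$ over $w,u\in\mathbb R_{\ge0}^{N+1}$ subject to $w_1-u_1=\sum_{i=1}^Nt_{0,i}x_{i,1}-a_1$; $w_j-w_{j-1}-u_j=a_{j-1}-a_j+\sum_{i=1}^Nd_ix_{i,j-1}+\sum_{i=1}^N\sum_{i'\in[N]\setminus\{i\}}t_{i,i'}x_{i,j-1}x_{i',j}$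 for $j\in[2,N]_{\mathbb Z}$; $w_{N+1}-w_N-u_{N+1}=a_N-a_{N+1}+\sum_{i=1}^Nd_ix_{i,N}$; where $A=\sum_{j=2}^N\sum_{i=1}^N\sum_{i'\in[N]\setminus\{i\}}t_{i,i'}x_{i,j-1}x_{i',j}+\sum_{i=1}^N(t_{0,i}x_{i,1}+t_{i,0}x_{i,N})$. Samples $\hat\xi^1,\dots,\hat\xi^R\in\mathcal S$ with $\hat\xi^r=(\hat t^r,\hat d^r)$ are given; $\hat{\mathbb P}^R=\frac1R\sum_{r=1}^R\delta_{\hat\xi^r}$ is the empirical distribution ($\delta$ the Dirac measure); $\epsilon>0$; $\mathcal F_1(\hat{\mathbb P}^R,\epsilon)$ is the set of probability distributions $\mathbb Q$ on $\mathcal S$ with $W_1(\mathbb Q,\hat{\mathbb P}^R)\le\epsilon$, where $W_1(\mathbb Q_1,\mathbb Q_2)=\inf_\Pi\mathbb E_\Pi\|\xi_1-\xi_2\|_1$ over all couplings $\Pi$ of $\mathbb Q_1,\mathbb Q_2$. Set $c^w_{N+1}=c^o$, $c^u_{N+1}=c^w_{N+2}=c^u_{N+2}=0$, and $\pi_{j,v}=-c^u_v+\sum_{l=j}^{v-1}c^w_l$ for $1\le j\le v\le N+2$. Bounds: $\underline u^r_{i,0}=\lambda\hat t^r_{i,0}$, $\overline u^r_{i,0}=\lambda\overline t_{i,0}$; $\underline u^r_{0,i,1,v}=(\pi_{1,v}+\lambda)\hat t^r_{0,i}$, $\overline u^r_{0,i,1,v}=\max\{(\pi_{1,v}+\lambda)\underline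 t_{0,i},(\pi_{1,v}+\lambda)\overline t_{0,i}\}$; $\underline u^r_{i,i',j,v}=(\pi_{j,v}+\lambda)\hat t^r_{i,i'}$, $\overline u^r_{i,i',j,v}=\max\{(\pi_{j,v}+\lambda)\underline t_{i,i'},(\pi_{j,v}+\lambda)\overline t_{i,i'}\}$; $\underline\nu^r_{i,j,v}=\pi_{j,v}\hat d^r_i$, $\overline\nu^r_{i,j,v}=\max\{\pi_{j,v}\underline d_i,\pi_{j,v}\overline d_i\}$. McCormick inequalities (for $i\in[N]$, $i'\in[N]\setminus\{i\}$, $j\in[2,N+1]_{\mathbb Z}$, $v\in[j,N+2]_{\mathbb Z}$, and $v\in[N+2]$ for $\sigma^r$; all $r\in[R]$): $\tau_{i,i',j-1,j}\ge x_{i,j-1}+x_{i',j}-1$, $\tau_{i,i',j-1,j}\ge0$, $\tau_{i,i',j-1,j}\le x_{i,j-1}$, $\tau_{i,i',j-1,j}\le x_{i',j}$; $\underline u^r_{i,0}x_{i,N}\le\psi^r_{i,0}\le\overline u^r_{i,0}x_{i,N}$, $u^r_{i,0}+\overline u^r_{i,0}(x_{i,N}-1)\le\psi^r_{i,0}\le u^r_{i,0}+\underline u^r_{i,0}(x_{i,N}-1)$; $\underline u^r_{i,i',j,v}\tau_{i,i',j-1,j}\le\phi^r_{i,i',j,v}\le\overline u^r_{i,i',j,v}\tau_{i,i',j-1,j}$, $u^r_{i,i',j,v}+\overline u^r_{i,i',j,v}(\tau_{i,i',j-1,j}-1)\le\phi^r_{i,i',j,v}\le u^r_{i,i',j,v}+\underline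 u^r_{i,i',j,v}(\tau_{i,i',j-1,j}-1)$; $\underline u^r_{0,i,1,v}x_{i,1}\le\sigma^r_{0,i,1,v}\le\overline u^r_{0,i,1,v}x_{i,1}$, $u^r_{0,i,1,v}+\overline u^r_{0,i,1,v}(x_{i,1}-1)\le\sigma^r_{0,i,1,v}\le u^r_{0,i,1,v}+\underline u^r_{0,i,1,v}(x_{i,1}-1)$; $\underline\nu^r_{i,j,v}x_{i,j-1}\le\zeta^r_{i,j,v}\le\overline\nu^r_{i,j,v}x_{i,j-1}$, $\nu^r_{i,j,v}+\overline\nu^r_{i,j,v}(x_{i,j-1}-1)\le\zeta^r_{i,j,v}\le\nu^r_{i,j,v}+\underline\nu^r_{i,j,v}(x_{i,j-1}-1)$.
   Formalization: Two assumptions are added, without which the claim is false: the unit costs satisfy c^u_{j+1} ≤ c^u_j + c^w_j for 1 ≤ j < N, and the lower bounds of the travel and service times defining S are nonnegative. *)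

theory Defs
  imports "HOL-Probability.Probability"
begin

text \<open>
  Customers and positions are the indices \<open>1, \<dots>, N\<close>, and index \<open>0\<close> is the depot. A scenario
  \<open>\<xi> = (t, d)\<close> pairs the travel times (on ordered pairs of distinct locations) with the
  service times.
\<close>

type_synonym scenario = "(nat \<times> nat \<Rightarrow> real) \<times> (nat \<Rightarrow> real)"

abbreviation trav :: "scenario \<Rightarrow> nat \<Rightarrow> nat \<Rightarrow> real" where
  "trav \<xi> i i' \<equiv> fst \<xi> (i, i')"

abbreviation serv :: "scenario \<Rightarrow> nat \<Rightarrow> real" where
  "serv \<xi> i \<equiv> snd \<xi> i"

record dhras =
  ncust :: nat                      \<comment> \<open>\<open>N\<close>\<close>
  len :: real                       \<comment> \<open>\<open>L\<close>\<close>
  cw :: "nat \<Rightarrow> real"               \<comment> \<open>\<open>c\<^sup>w\<close>, used on \<open>[N]\<close>\<close>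
  cu :: "nat \<Rightarrow> real"               \<comment> \<open>\<open>c\<^sup>u\<close>, used on \<open>[N]\<close>\<close>
  co :: real                        \<comment> \<open>\<open>c\<^sup>o\<close>\<close>
  lam :: real                       \<comment> \<open>\<open>\<lambda>\<close>\<close>
  tlo :: "nat \<times> nat \<Rightarrow> real"
  thi :: "nat \<times> nat \<Rightarrow> real"
  dlo :: "nat \<Rightarrow> real"
  dhi :: "nat \<Rightarrow> real"
  nsamp :: nat                      \<comment> \<open>\<open>R\<close>\<close>
  samp :: "nat \<Rightarrow> scenario"         \<comment> \<open>the samples, used on \<open>[R]\<close>\<close>
  eps :: real                       \<comment> \<open>\<open>\<epsilon>\<close>\<close>

definition arcs :: "dhras \<Rightarrow> (nat \<times> nat) set" where
  "arcs P = {(i, i'). i \<le> ncust P \<and> i' \<le> ncust P \<and> i \<noteq> i'}"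


subsection \<open>First-stage decisions\<close>

definition assignments :: "dhras \<Rightarrow> (nat \<Rightarrow> nat \<Rightarrow> real) set" where
  "assignments P = {x \<in> {1..ncust P} \<rightarrow>\<^sub>E {1..ncust P} \<rightarrow>\<^sub>E {0, 1}.
     (\<forall>j\<in>{1..ncust P}. (\<Sum>i=1..ncust P. x i j) = 1) \<and>
     (\<forall>i\<in>{1..ncust P}. (\<Sum>j=1..ncust P. x i j) = 1)}"

definition appointments :: "dhras \<Rightarrow> (nat \<Rightarrow> real) set" where
  "appointments P = {a \<in> {1..ncust P} \<rightarrow>\<^sub>E {0..len P}. \<forall>j\<in>{2..ncust P}. a (j - 1) \<le> a j}"

text \<open>The conventions \<open>a\<^bsub>N+1\<^esub> = L\<close> and \<open>x\<^bsub>i,N+1\<^esub> = 0\<close>.\<close>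

definition aext :: "dhras \<Rightarrow> (nat \<Rightarrow> real) \<Rightarrow> nat \<Rightarrow> real" where
  "aext P a j = (if j = ncust P + 1 then len P else a j)"

definition xext :: "dhras \<Rightarrow> (nat \<Rightarrow> nat \<Rightarrow> real) \<Rightarrow> nat \<Rightarrow> nat \<Rightarrow> real" where
  "xext P x i j = (if j = ncust P + 1 then 0 else x i j)"


subsection \<open>The second-stage linear program\<close>

definition travel_between ::
    "dhras \<Rightarrow> (nat \<Rightarrow> nat \<Rightarrow> real) \<Rightarrow> scenario \<Rightarrow> nat \<Rightarrow> real" where
  "travel_between P x \<xi> j =
     (\<Sum>i=1..ncust P. \<Sum>i'\<in>{1..ncust P} - {i}. trav \<xi> i i' * x i (j - 1) * x i' j)"

definition total_travel :: "dhras \<Rightarrow> (nat \<Rightarrow> nat \<Rightarrow> real) \<Rightarrow> scenario \<Rightarrow> real" where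
  "total_travel P x \<xi> =
     (\<Sum>j=2..ncust P. travel_between P x \<xi> j) +
     (\<Sum>i=1..ncust P. trav \<xi> 0 i * x i 1 + trav \<xi> i 0 * x i (ncust P))"

definition lp_feasible :: "dhras \<Rightarrow> (nat \<Rightarrow> nat \<Rightarrow> real) \<Rightarrow> (nat \<Rightarrow> real) \<Rightarrow> scenario \<Rightarrow>
    (nat \<Rightarrow> real) \<Rightarrow> (nat \<Rightarrow> real) \<Rightarrow> bool" where
  "lp_feasible P x a \<xi> w u \<longleftrightarrow>
     (\<forall>j\<in>{1..ncust P + 1}. 0 \<le> w j \<and> 0 \<le> u j) \<and>
     w 1 - u 1 = (\<Sum>i=1..ncust P. trav \<xi> 0 i * x i 1) - a 1 \<and>
     (\<forall>j\<in>{2..ncust P}. w j - w (j - 1) - u j =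
        a (j - 1) - a j + (\<Sum>i=1..ncust P. serv \<xi> i * x i (j - 1)) + travel_between P x \<xi> j) \<and>
     w (ncust P + 1) - w (ncust P) - u (ncust P + 1) =
        a (ncust P) - aext P a (ncust P + 1) + (\<Sum>i=1..ncust P. serv \<xi> i * x i (ncust P))"

definition lp_objective :: "dhras \<Rightarrow> (nat \<Rightarrow> nat \<Rightarrow> real) \<Rightarrow> scenario \<Rightarrow>
    (nat \<Rightarrow> real) \<Rightarrow> (nat \<Rightarrow> real) \<Rightarrow> real" where
  "lp_objective P x \<xi> w u =
     (\<Sum>j=1..ncust P. cw P j * w j + cu P j * u j) + co P * w (ncust P + 1)
       + lam P * total_travel P x \<xi>"

text \<open>
  The linear program is always feasible, and bounded below when the unit costs are nonnegative,
  so this real infimum is its optimal value.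
\<close>

definition second_stage ::
    "dhras \<Rightarrow> (nat \<Rightarrow> nat \<Rightarrow> real) \<Rightarrow> (nat \<Rightarrow> real) \<Rightarrow> scenario \<Rightarrow> real" where
  "second_stage P x a \<xi> = Inf {lp_objective P x \<xi> w u | w u. lp_feasible P x a \<xi> w u}"


subsection \<open>The Wasserstein ambiguity set\<close>

definition scenario_space :: "dhras \<Rightarrow> scenario measure" where
  "scenario_space P = PiM (arcs P) (\<lambda>_. borel) \<Otimes>\<^sub>M PiM {1..ncust P} (\<lambda>_. borel)"

definition support :: "dhras \<Rightarrow> scenario set" where
  "support P = {\<xi> \<in> space (scenario_space P).
     (\<forall>e\<in>arcs P. 0 \<le> fst \<xi> e \<and> tlo P e \<le> fst \<xi> e \<and> fst \<xi> e \<le> thi P e) \<and>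
     (\<forall>i\<in>{1..ncust P}. 0 \<le> snd \<xi> i \<and> dlo P i \<le> snd \<xi> i \<and> snd \<xi> i \<le> dhi P i)}"

definition support_space :: "dhras \<Rightarrow> scenario measure" where
  "support_space P = restrict_space (scenario_space P) (support P)"

definition dist1 :: "dhras \<Rightarrow> scenario \<Rightarrow> scenario \<Rightarrow> real" where
  "dist1 P \<xi> \<xi>' =
     (\<Sum>e\<in>arcs P. \<bar>fst \<xi> e - fst \<xi>' e\<bar>) + (\<Sum>i=1..ncust P. \<bar>snd \<xi> i - snd \<xi>' i\<bar>)"

definition couplings :: "'a measure \<Rightarrow> 'b measure \<Rightarrow> ('a \<times> 'b) measure set" where
  "couplings Q1 Q2 = {M. prob_space M \<and> sets M = sets (Q1 \<Otimes>\<^sub>M Q2) \<and>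
     distr M Q1 fst = Q1 \<and> distr M Q2 snd = Q2}"

definition wasserstein1 :: "dhras \<Rightarrow> scenario measure \<Rightarrow> scenario measure \<Rightarrow> ennreal" where
  "wasserstein1 P Q1 Q2 =
     (INF M\<in>couplings Q1 Q2. \<integral>\<^sup>+ z. ennreal (dist1 P (fst z) (snd z)) \<partial>M)"

definition empirical :: "dhras \<Rightarrow> scenario measure" where
  "empirical P = measure_of (space (support_space P)) (sets (support_space P))
     (\<lambda>A. ennreal (1 / real (nsamp P)) *
           (\<Sum>r=1..nsamp P. emeasure (return (support_space P) (samp P r)) A))"

definition ambiguity :: "dhras \<Rightarrow> scenario measure set" where
  "ambiguity P = {Q. prob_space Q \<and> sets Q = sets (support_space P) \<and>
     wasserstein1 P Q (empirical P) \<le> ennreal (eps P)}"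


subsection \<open>The min-max problem W-DHRAS\<close>

definition worst_case :: "dhras \<Rightarrow> (nat \<Rightarrow> nat \<Rightarrow> real) \<Rightarrow> (nat \<Rightarrow> real) \<Rightarrow> ereal" where
  "worst_case P x a = (SUP Q\<in>ambiguity P. ereal (\<integral>\<xi>. second_stage P x a \<xi> \<partial>Q))"

definition wdhras_value :: "dhras \<Rightarrow> ereal" where
  "wdhras_value P = (INF (x, a)\<in>assignments P \<times> appointments P. worst_case P x a)"

definition wdhras_optimal :: "dhras \<Rightarrow> (nat \<Rightarrow> nat \<Rightarrow> real) \<Rightarrow> (nat \<Rightarrow> real) \<Rightarrow> bool" where
  "wdhras_optimal P x a \<longleftrightarrow> x \<in> assignments P \<and> a \<in> appointments P \<and>
     (\<forall>x'\<in>assignments P. \<forall>a'\<in>appointments P. worst_case P x a \<le> worst_case P x' a')"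


subsection \<open>The mixed-integer linear program\<close>

definition cwext :: "dhras \<Rightarrow> nat \<Rightarrow> real" where
  "cwext P j = (if j \<le> ncust P then cw P j else if j = ncust P + 1 then co P else 0)"

definition cuext :: "dhras \<Rightarrow> nat \<Rightarrow> real" where
  "cuext P j = (if j \<le> ncust P then cu P j else 0)"

text \<open>
  The value of the \<open>j\<close>-th dual variable of the second-stage program at the dual point whose block
  \<open>{j, \<dots>, v}\<close> is tied together and anchored at \<open>v\<close>. These points are dual feasible for every
  choice of blocks exactly when \<open>c\<^sup>u\<^bsub>j+1\<^esub> \<le> c\<^sup>u\<^bsub>j\<^esub> + c\<^sup>w\<^bsub>j\<^esub>\<close> for \<open>1 \<le> j < N\<close>.
\<close>

definition dpi :: "dhras \<Rightarrow> nat \<Rightarrow> nat \<Rightarrow> real" where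
  "dpi P j v = - cuext P v + (\<Sum>l=j..<v. cwext P l)"

text \<open>
  The variables other than \<open>(x, a)\<close>. The family \<open>u\<close> is split by the kind of arc:
  \<open>u_ret r i\<close> is \<open>u\<^sup>r\<^bsub>i,0\<^esub>\<close>, \<open>u_dep r i v\<close> is \<open>u\<^sup>r\<^bsub>0,i,1,v\<^esub>\<close> and \<open>u_link r i i' j v\<close> is
  \<open>u\<^sup>r\<^bsub>i,i',j,v\<^esub>\<close>. Further, \<open>lin_tau i i' j\<close> is \<open>\<tau>\<^bsub>i,i',j-1,j\<^esub>\<close> and \<open>lin_sigma r i v\<close> is
  \<open>\<sigma>\<^sup>r\<^bsub>0,i,1,v\<^esub>\<close>. Values outside the index ranges of the program are never used.
\<close>

record milp_vars =
  rho :: real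
  beta :: "nat \<Rightarrow> nat \<Rightarrow> real"
  u_ret :: "nat \<Rightarrow> nat \<Rightarrow> real"
  u_dep :: "nat \<Rightarrow> nat \<Rightarrow> nat \<Rightarrow> real"
  u_link :: "nat \<Rightarrow> nat \<Rightarrow> nat \<Rightarrow> nat \<Rightarrow> nat \<Rightarrow> real"
  nu_serv :: "nat \<Rightarrow> nat \<Rightarrow> nat \<Rightarrow> nat \<Rightarrow> real"
  lin_tau :: "nat \<Rightarrow> nat \<Rightarrow> nat \<Rightarrow> real"
  lin_psi :: "nat \<Rightarrow> nat \<Rightarrow> real"
  lin_phi :: "nat \<Rightarrow> nat \<Rightarrow> nat \<Rightarrow> nat \<Rightarrow> nat \<Rightarrow> real"
  lin_sigma :: "nat \<Rightarrow> nat \<Rightarrow> nat \<Rightarrow> real"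
  lin_zeta :: "nat \<Rightarrow> nat \<Rightarrow> nat \<Rightarrow> nat \<Rightarrow> real"

definition mccormick :: "real \<Rightarrow> real \<Rightarrow> real \<Rightarrow> real \<Rightarrow> real \<Rightarrow> bool" where
  "mccormick lo hi y b z \<longleftrightarrow>
     lo * b \<le> z \<and> z \<le> hi * b \<and> y + hi * (b - 1) \<le> z \<and> z \<le> y + lo * (b - 1)"

definition mccormick_constraints ::
    "dhras \<Rightarrow> (nat \<Rightarrow> nat \<Rightarrow> real) \<Rightarrow> milp_vars \<Rightarrow> bool" where
  "mccormick_constraints P x y \<longleftrightarrow>
     (\<forall>i\<in>{1..ncust P}. \<forall>i'\<in>{1..ncust P} - {i}. \<forall>j\<in>{2..ncust P + 1}.
        xext P x i (j - 1) + xext P x i' j - 1 \<le> lin_tau y i i' j \<and>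
        0 \<le> lin_tau y i i' j \<and>
        lin_tau y i i' j \<le> xext P x i (j - 1) \<and>
        lin_tau y i i' j \<le> xext P x i' j) \<and>
     (\<forall>r\<in>{1..nsamp P}. \<forall>i\<in>{1..ncust P}.
        mccormick (lam P * trav (samp P r) i 0) (lam P * thi P (i, 0))
          (u_ret y r i) (x i (ncust P)) (lin_psi y r i)) \<and>
     (\<forall>r\<in>{1..nsamp P}. \<forall>i\<in>{1..ncust P}. \<forall>i'\<in>{1..ncust P} - {i}.
        \<forall>j\<in>{2..ncust P + 1}. \<forall>v\<in>{j..ncust P + 2}.
        mccormick ((dpi P j v + lam P) * trav (samp P r) i i')
          (max ((dpi P j v + lam P) * tlo P (i, i')) ((dpi P j v + lam P) * thi P (i, i')))
          (u_link y r i i' j v) (lin_tau y i i' j) (lin_phi y r i i' j v)) \<and>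
     (\<forall>r\<in>{1..nsamp P}. \<forall>i\<in>{1..ncust P}. \<forall>v\<in>{1..ncust P + 2}.
        mccormick ((dpi P 1 v + lam P) * trav (samp P r) 0 i)
          (max ((dpi P 1 v + lam P) * tlo P (0, i)) ((dpi P 1 v + lam P) * thi P (0, i)))
          (u_dep y r i v) (x i 1) (lin_sigma y r i v)) \<and>
     (\<forall>r\<in>{1..nsamp P}. \<forall>i\<in>{1..ncust P}. \<forall>j\<in>{2..ncust P + 1}. \<forall>v\<in>{j..ncust P + 2}.
        mccormick (dpi P j v * serv (samp P r) i)
          (max (dpi P j v * dlo P i) (dpi P j v * dhi P i))
          (nu_serv y r i j v) (x i (j - 1)) (lin_zeta y r i j v))"

definition beta_constraints ::
    "dhras \<Rightarrow> (nat \<Rightarrow> real) \<Rightarrow> milp_vars \<Rightarrow> nat \<Rightarrow> bool" where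
  "beta_constraints P a y r \<longleftrightarrow>
     beta y r 1 \<ge> - a 1 * dpi P 1 1 + (\<Sum>i=1..ncust P. lin_sigma y r i 1) \<and>
     (\<forall>v\<in>{2..ncust P + 2}.
        (\<Sum>j=1..v. beta y r j) \<ge>
          - a 1 * dpi P 1 v
          + (\<Sum>j=2..min v (ncust P + 1). (aext P a (j - 1) - aext P a j) * dpi P j v)
          + (\<Sum>i=1..ncust P. lin_sigma y r i v)
          + (\<Sum>j=2..min v (ncust P + 1). \<Sum>i=1..ncust P. \<Sum>i'\<in>{1..ncust P} - {i}.
               lin_phi y r i i' j v)
          + (\<Sum>j=2..min v (ncust P + 1). \<Sum>i=1..ncust P. lin_zeta y r i j v)) \<and>
     (\<forall>k\<in>{2..ncust P + 1}. \<forall>v\<in>{k..ncust P + 2}.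
        (\<Sum>j=k..v. beta y r j) \<ge>
          (\<Sum>j=k..min v (ncust P + 1). (aext P a (j - 1) - aext P a j) * dpi P j v)
          + (\<Sum>j=k..min v (ncust P + 1). \<Sum>i=1..ncust P. lin_zeta y r i j v)
          + (\<Sum>j=k..min v (ncust P + 1). \<Sum>i=1..ncust P. \<Sum>i'\<in>{1..ncust P} - {i}.
               lin_phi y r i i' j v)) \<and>
     beta y r (ncust P + 2) \<ge> 0"

text \<open>
  The three lower bounds on a variable that represents the maximum of
  \<open>c * s - \<rho> * \<bar>s - mid\<bar>\<close> over \<open>lo \<le> s \<le> hi\<close>.
\<close>

definition above_three :: "real \<Rightarrow> real \<Rightarrow> real \<Rightarrow> real \<Rightarrow> real \<Rightarrow> real \<Rightarrow> bool" where
  "above_three z c \<rho> lo mid hi \<longleftrightarrow>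
     z \<ge> c * lo - \<rho> * (mid - lo) \<and> z \<ge> c * mid \<and> z \<ge> c * hi - \<rho> * (hi - mid)"

definition transport_constraints :: "dhras \<Rightarrow> milp_vars \<Rightarrow> nat \<Rightarrow> bool" where
  "transport_constraints P y r \<longleftrightarrow>
     (\<forall>i\<in>{1..ncust P}.
        u_ret y r i \<ge> lam P * trav (samp P r) i 0 \<and>
        u_ret y r i \<ge> lam P * thi P (i, 0) - rho y * (thi P (i, 0) - trav (samp P r) i 0)) \<and>
     (\<forall>i\<in>{1..ncust P}. \<forall>v\<in>{1..ncust P + 2}.
        above_three (u_dep y r i v) (dpi P 1 v + lam P) (rho y)
          (tlo P (0, i)) (trav (samp P r) 0 i) (thi P (0, i))) \<and>
     (\<forall>i\<in>{1..ncust P}. \<forall>i'\<in>{1..ncust P} - {i}. \<forall>j\<in>{2..ncust P + 1}. \<forall>v\<in>{j..ncust P + 2}.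
        above_three (u_link y r i i' j v) (dpi P j v + lam P) (rho y)
          (tlo P (i, i')) (trav (samp P r) i i') (thi P (i, i'))) \<and>
     (\<forall>i\<in>{1..ncust P}. \<forall>j\<in>{2..ncust P + 1}. \<forall>v\<in>{j..ncust P + 2}.
        above_three (nu_serv y r i j v) (dpi P j v) (rho y)
          (dlo P i) (serv (samp P r) i) (dhi P i))"

definition milp_feasible ::
    "dhras \<Rightarrow> (nat \<Rightarrow> nat \<Rightarrow> real) \<Rightarrow> (nat \<Rightarrow> real) \<Rightarrow> milp_vars \<Rightarrow> bool" where
  "milp_feasible P x a y \<longleftrightarrow>
     x \<in> assignments P \<and> a \<in> appointments P \<and> 0 \<le> rho y \<and>
     (\<forall>r\<in>{1..nsamp P}. beta_constraints P a y r \<and> transport_constraints P y r) \<and>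
     mccormick_constraints P x y"

definition milp_objective :: "dhras \<Rightarrow> milp_vars \<Rightarrow> real" where
  "milp_objective P y = eps P * rho y +
     1 / real (nsamp P) *
       (\<Sum>r=1..nsamp P. (\<Sum>i=1..ncust P. lin_psi y r i) + (\<Sum>j=1..ncust P + 2. beta y r j))"

definition milp_value :: "dhras \<Rightarrow> ereal" where
  "milp_value P = (INF (x, a, y)\<in>{(x, a, y). milp_feasible P x a y}. ereal (milp_objective P y))"

definition milp_optimal ::
    "dhras \<Rightarrow> (nat \<Rightarrow> nat \<Rightarrow> real) \<Rightarrow> (nat \<Rightarrow> real) \<Rightarrow> milp_vars \<Rightarrow> bool" where
  "milp_optimal P x a y \<longleftrightarrow> milp_feasible P x a y \<and>
     (\<forall>x' a' y'. milp_feasible P x' a' y' \<longrightarrow> milp_objective P y \<le> milp_objective P y')"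

end

theory Submission
  imports Defs
begin

text \<open>
  Under the cost condition, the second-stage value is the maximum of a dual objective over the
  partitions of \<open>{1, \<dots>, N + 2}\<close> into intervals: serving every customer as early as possible is
  optimal, and complementary slackness ties \<open>j\<close> to \<open>j + 1\<close> when customer \<open>j\<close> waits. For fixed \<open>x\<close> and a
  fixed partition the dual objective is affine in the scenario, so subtracting \<open>\<rho>\<close> times the
  \<open>1\<close>-norm distance to a sample leaves a separable maximization, each coordinate of which is
  attained at an end point of its range or at the sample. Maximizing over partitions is a longest
  path problem, whose potentials are the variables \<open>\<beta>\<close>.

  Integrating this bound over a coupling gives weak duality. For strong duality, two-point mixtures
  of empirical measures already suffice: that they respect the worst-case value yields a multiplier
  \<open>\<rho>\<close> directly, as the slope of a supporting line of the value as a function of the transport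
  budget, so the minimum over \<open>\<rho>\<close> is attained.
\<close>

subsection \<open>Interval partitions and one-dimensional duality\<close>

text \<open>A partition of \<open>{0..n}\<close> into intervals, with \<open>e j\<close> the right
  end of the interval that contains \<open>j\<close>. The local form (each \<open>j\<close> closes
  its interval or shares the end of \<open>Suc j\<close>) is the case distinction on which dual
  feasibility rests.\<close>

definition block_ends :: "nat \<Rightarrow> (nat \<Rightarrow> nat) \<Rightarrow> bool" where
  "block_ends n e \<longleftrightarrow> e n = n \<and> (\<forall>j<n. e j = j \<or> e j = e (Suc j))"

lemma block_ends_bounds:
  assumes "block_ends n e" "j \<le> n"
  shows "j \<le> e j" "e j \<le> n"
proof -
  have "j \<le> e j \<and> e j \<le> n"
    using \<open>j \<le> n\<close>
  proof (induction rule: inc_induct)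
    case base
    then show ?case using assms(1) by (simp add: block_ends_def)
  next
    case (step k)
    have "e k = k \<or> e k = e (Suc k)" using assms(1) step(2) by (auto simp: block_ends_def)
    then show ?case using step by auto
  qed
  then show "j \<le> e j" "e j \<le> n" by auto
qed

text \<open>Walking up from \<open>j\<close>: an index \<open>k\<close> with end \<open>e j\<close>
  that lies strictly below \<open>e j\<close> does not close its interval, so it passes its end on
  to \<open>Suc k\<close>.\<close>

lemma block_ends_const:
  assumes "block_ends n e" "j \<le> i" "i \<le> e j" "j \<le> n"
  shows "e i = e j"
  using assms(2,3)
proof (induction rule: dec_induct)
  case base
  then show ?case by simp
next
  case (step k)
  then have "e k = e j" "k < e j" by auto
  moreover have "k < n" using block_ends_bounds(2)[OF assms(1,4)] calculation by simp
  ultimately have "e k = e (Suc k)" using assms(1) by (auto simp: block_ends_def)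
  then show ?case using \<open>e k = e j\<close> by simp
qed

lemma block_ends_exist:
  "\<exists>e. block_ends n e \<and> (\<forall>j<n. e j = (if tied j then e (Suc j) else j))"
proof -
  \<comment> \<open>The end is the first untied position from \<open>j\<close> on, with
    \<open>n\<close> as the stop.\<close>
  define e where "e j = (LEAST v. j \<le> v \<and> (v = n \<or> \<not> tied v))" for j
  have "e n = n" unfolding e_def by (rule Least_equality) auto
  moreover have "e j = (if tied j then e (Suc j) else j)" if "j < n" for j
  proof (cases "tied j")
    case True
    have "(j \<le> v \<and> (v = n \<or> \<not> tied v)) = (Suc j \<le> v \<and> (v = n \<or> \<not> tied v))" for v
      using True that by (cases "v = j") auto
    then have "e j = e (Suc j)" unfolding e_def by presburger
    then show ?thesis using True by simp
  next
    case False
    then have "e j = j" unfolding e_def by (intro Least_equality) auto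
    then show ?thesis using False by simp
  qed
  ultimately show ?thesis unfolding block_ends_def by (intro exI[of _ e] conjI allI impI) metis+
qed

text \<open>Intervals are peeled off from the left: on \<open>{k..e k}\<close> the end is constantly
  \<open>e k\<close>, so the hypothesis applies to the whole interval, and induction on the
  remaining length does the rest.\<close>

lemma block_sum_le:
  fixes g :: "nat \<Rightarrow> nat \<Rightarrow> real"
  assumes e: "block_ends n e"
    and g: "\<And>k v. 1 \<le> k \<Longrightarrow> k \<le> v \<Longrightarrow> v \<le> n \<Longrightarrow> (\<Sum>j=k..v. g j v) \<le> (\<Sum>j=k..v. b j)"
    and "1 \<le> k"
  shows "(\<Sum>j=k..n. g j (e j)) \<le> (\<Sum>j=k..n. b j)"
  using \<open>1 \<le> k\<close>
proof (induction "Suc n - k" arbitrary: k rule: less_induct)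
  case less
  show ?case
  proof (cases "k \<le> n")
    case True
    define v where "v = e k"
    have v: "k \<le> v" "v \<le> n" using block_ends_bounds[OF e True] by (auto simp: v_def)
    have split: "(\<Sum>j=k..n. h j) = (\<Sum>j=k..v. h j) + (\<Sum>j=Suc v..n. h j)" for h :: "nat \<Rightarrow> real"
      using v sum.ub_add_nat[of k v h "n - v"] by simp
    have "e j = v" if "j \<in> {k..v}" for j
      using block_ends_const[OF e _ _ True, of j] that unfolding v_def by simp
    then have "(\<Sum>j=k..v. g j (e j)) = (\<Sum>j=k..v. g j v)"
      by simp
    also have "\<dots> \<le> (\<Sum>j=k..v. b j)" using less.prems v by (intro g)
    finally have "(\<Sum>j=k..v. g j (e j)) \<le> (\<Sum>j=k..v. b j)" .
    moreover have "(\<Sum>j=Suc v..n. g j (e j)) \<le> (\<Sum>j=Suc v..n. b j)"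
      using True v by (intro less.hyps) auto
    ultimately show ?thesis unfolding split by linarith
  qed simp
qed

text \<open>
  Longest-path potentials: \<open>\<Sum>j=k..n. b j\<close> is the largest total weight of a partition of
  \<open>{k..n}\<close> into intervals, the interval \<open>{i..v}\<close> weighing \<open>\<Sum>j=i..v. g j v\<close>.
\<close>

lemma block_potential:
  fixes g :: "nat \<Rightarrow> nat \<Rightarrow> real"
  obtains b e where "block_ends n e"
    "\<And>k v. 1 \<le> k \<Longrightarrow> k \<le> v \<Longrightarrow> v \<le> n \<Longrightarrow> (\<Sum>j=k..v. g j v) \<le> (\<Sum>j=k..v. b j)"
    "(\<Sum>j=1..n. b j) = (\<Sum>j=1..n. g j (e j))"
proof -
  \<comment> \<open>The start of the range moves down from \<open>Suc n\<close>, where all sums are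
    empty, to \<open>1\<close>. The claim keeps optimal partitions for all later starts, so that a
    first interval of any length can be put in front.\<close>
  have "\<exists>b. (\<forall>i v. 1 \<le> i \<and> i \<le> v \<and> v \<le> n \<longrightarrow> (\<Sum>j=i..v. g j v) \<le> (\<Sum>j=i..v. b j)) \<and>
    (\<forall>i\<in>{1..Suc n}. \<exists>e. block_ends n e \<and> (\<Sum>j=i..n. b j) = (\<Sum>j=i..n. g j (e j)))"
  proof (rule inc_induct[of 1 "Suc n"])
    show "\<exists>b. (\<forall>i v. Suc n \<le> i \<and> i \<le> v \<and> v \<le> n \<longrightarrow> (\<Sum>j=i..v. g j v) \<le> (\<Sum>j=i..v. b j)) \<and>
      (\<forall>i\<in>{Suc n..Suc n}. \<exists>e. block_ends n e \<and> (\<Sum>j=i..n. b j) = (\<Sum>j=i..n. g j (e j)))"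
      by (auto simp: block_ends_def intro!: exI[of _ id])
  next
    fix k
    assume k: "1 \<le> k" "k < Suc n"
      and "\<exists>b. (\<forall>i v. Suc k \<le> i \<and> i \<le> v \<and> v \<le> n \<longrightarrow> (\<Sum>j=i..v. g j v) \<le> (\<Sum>j=i..v. b j)) \<and>
      (\<forall>i\<in>{Suc k..Suc n}. \<exists>e. block_ends n e \<and> (\<Sum>j=i..n. b j) = (\<Sum>j=i..n. g j (e j)))"
    then obtain b where
      b: "\<And>i v. Suc k \<le> i \<Longrightarrow> i \<le> v \<Longrightarrow> v \<le> n \<Longrightarrow> (\<Sum>j=i..v. g j v) \<le> (\<Sum>j=i..v. b j)"
      and ex: "\<And>i. i\<in>{Suc k..Suc n} \<Longrightarrow>
        \<exists>e. block_ends n e \<and> (\<Sum>j=i..n. b j) = (\<Sum>j=i..n. g j (e j))"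
      by blast
    \<comment> \<open>\<open>T v\<close> is the best total weight on \<open>{k..n}\<close> when the
      first interval is \<open>{k..v}\<close>.\<close>
    define T where "T v = (\<Sum>j=k..v. g j v) + (\<Sum>j=Suc v..n. b j)" for v
    have fin: "finite (T ` {k..n})" "T ` {k..n} \<noteq> {}" using k by auto
    obtain v where v: "v \<in> {k..n}" and Tv: "T v = Max (T ` {k..n})"
      using Max_in[OF fin] by auto
    have Tmax: "T w \<le> T v" if "w \<in> {k..n}" for w using fin that by (simp add: Tv)
    \<comment> \<open>Only the entry at \<open>k\<close> changes, so that the sum over
      \<open>{k..n}\<close> becomes the maximum \<open>T v\<close>. The inequalities starting at
      \<open>k\<close> then amount to \<open>T w \<le> T v\<close>.\<close>
    define b' where "b' = b(k := T v - (\<Sum>j=Suc k..n. b j))"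
    have later: "(\<Sum>j=i..w. b' j) = (\<Sum>j=i..w. b j)" if "Suc k \<le> i" for i w
      using that by (intro sum.cong) (auto simp: b'_def)
    have first: "(\<Sum>j=k..w. b' j) = T v - (\<Sum>j=Suc w..n. b j)" if "w \<in> {k..n}" for w
    proof -
      have "(\<Sum>j=k..w. b' j) = b' k + (\<Sum>j=Suc k..w. b j)"
        using that later by (simp add: sum.atLeast_Suc_atMost)
      moreover have "(\<Sum>j=Suc k..n. b j) = (\<Sum>j=Suc k..w. b j) + (\<Sum>j=Suc w..n. b j)"
        using that sum.ub_add_nat[of "Suc k" w b "n - w"] by simp
      ultimately show ?thesis by (simp add: b'_def)
    qed
    have "(\<Sum>j=i..w. g j w) \<le> (\<Sum>j=i..w. b' j)" if "k \<le> i" "i \<le> w" "w \<le> n" for i w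
    proof (cases "i = k")
      case True
      have "T w \<le> T v" using that True by (intro Tmax) auto
      then show ?thesis using first[of w] that True by (simp add: T_def[of w])
    next
      case False
      then show ?thesis using b[of i w] later[of i w] that by simp
    qed
    moreover have "\<exists>e. block_ends n e \<and> (\<Sum>j=i..n. b' j) = (\<Sum>j=i..n. g j (e j))"
      if "i \<in> {k..Suc n}" for i
    proof (cases "i = k")
      case True
      obtain e where e: "block_ends n e" and es: "(\<Sum>j=Suc v..n. b j) = (\<Sum>j=Suc v..n. g j (e j))"
        using ex[of "Suc v"] v by auto
      \<comment> \<open>The interval ending in \<open>v\<close> precedes an optimal partition of the
        rest. Indices below \<open>k\<close> also get the end \<open>v\<close>, because
        \<open>block_ends\<close> speaks of all of \<open>{0..n}\<close>.\<close>
      define e' where "e' j = (if j \<le> v then v else e j)" for j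
      have "block_ends n e'" using e v unfolding block_ends_def e'_def by auto
      moreover have "(\<Sum>j=k..n. g j (e' j)) = (\<Sum>j=k..v. g j v) + (\<Sum>j=Suc v..n. g j (e j))"
      proof -
        have "(\<Sum>j=k..n. g j (e' j)) = (\<Sum>j=k..v. g j (e' j)) + (\<Sum>j=Suc v..n. g j (e' j))"
          using v sum.ub_add_nat[of k v "\<lambda>j. g j (e' j)" "n - v"] by simp
        then show ?thesis by (simp add: e'_def)
      qed
      moreover have "(\<Sum>j=k..n. b' j) = T v" using first[of n] k by simp
      ultimately show ?thesis using es True by (auto simp: T_def)
    next
      case False
      then show ?thesis using ex[of i] later[of i n] that by auto
    qed
    ultimately show "\<exists>b. (\<forall>i v. k \<le> i \<and> i \<le> v \<and> v \<le> n \<longrightarrow>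
        (\<Sum>j=i..v. g j v) \<le> (\<Sum>j=i..v. b j)) \<and>
      (\<forall>i\<in>{k..Suc n}. \<exists>e. block_ends n e \<and> (\<Sum>j=i..n. b j) = (\<Sum>j=i..n. g j (e j)))"
      by (intro exI[of _ b']) auto
  qed simp
  then obtain b
    where b: "\<forall>i v. 1 \<le> i \<and> i \<le> v \<and> v \<le> n \<longrightarrow> (\<Sum>j=i..v. g j v) \<le> (\<Sum>j=i..v. b j)"
    and "\<exists>e. block_ends n e \<and> (\<Sum>j=1..n. b j) = (\<Sum>j=1..n. g j (e j))"
    by force
  then obtain e where "block_ends n e" "(\<Sum>j=1..n. b j) = (\<Sum>j=1..n. g j (e j))"
    by blast
  with b show ?thesis by (intro that[of e b]) blast+
qed

text \<open>
  The multiplier is the largest slope of a chord from \<open>(\<epsilon>, V)\<close> to a point \<open>(\<delta> k, \<alpha> k)\<close> to its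
  right; feasibility of the two-point mixtures bounds these slopes by those on the left.
\<close>

lemma budget_multiplier:
  fixes \<alpha> \<delta> :: "'k \<Rightarrow> real"
  assumes mix: "\<And>k k' \<theta>. k \<in> K \<Longrightarrow> k' \<in> K \<Longrightarrow> 0 \<le> \<theta> \<Longrightarrow> \<theta> \<le> 1 \<Longrightarrow>
      (1 - \<theta>) * \<delta> k + \<theta> * \<delta> k' \<le> \<epsilon> \<Longrightarrow> (1 - \<theta>) * \<alpha> k + \<theta> * \<alpha> k' \<le> V"
    and slater: "k0 \<in> K" "\<delta> k0 < \<epsilon>"
  obtains \<rho> where "0 \<le> \<rho>" "\<And>k. k \<in> K \<Longrightarrow> \<alpha> k - \<rho> * (\<delta> k - \<epsilon>) \<le> V"
proof -
  \<comment> \<open>The element 0 makes the multiplier nonnegative and keeps the supremum meaningful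
    when no point exceeds the budget.\<close>
  define S where "S = insert 0 {(\<alpha> k - V) / (\<delta> k - \<epsilon>) | k. k \<in> K \<and> \<epsilon> < \<delta> k}"
  have single: "\<alpha> k \<le> V" if "k \<in> K" "\<delta> k \<le> \<epsilon>" for k
    using mix[of k k 0] that by simp
  have bound: "s \<le> (V - \<alpha> k) / (\<epsilon> - \<delta> k)" if s: "s \<in> S" and k: "k \<in> K" "\<delta> k < \<epsilon>" for s k
  proof (cases "s = 0")
    case True
    then show ?thesis using single[of k] k by simp
  next
    case False
    then obtain k' where k': "k' \<in> K" "\<epsilon> < \<delta> k'" "s = (\<alpha> k' - V) / (\<delta> k' - \<epsilon>)"
      using s by (auto simp: S_def)
    \<comment> \<open>The weight at which the two-point mixture spends exactly the budget
      \<open>\<epsilon>\<close>.\<close>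
    define \<theta> where "\<theta> = (\<epsilon> - \<delta> k) / (\<delta> k' - \<delta> k)"
    have d: "\<delta> k' - \<delta> k > 0" using k k' by simp
    have \<theta>: "\<theta> * (\<delta> k' - \<delta> k) = \<epsilon> - \<delta> k" using d by (simp add: \<theta>_def)
    have "0 \<le> \<theta>" "\<theta> \<le> 1" using k k' d by (auto simp: \<theta>_def)
    moreover have "(1 - \<theta>) * \<delta> k + \<theta> * \<delta> k' \<le> \<epsilon>" using \<theta> by (simp add: algebra_simps)
    ultimately have "(1 - \<theta>) * \<alpha> k + \<theta> * \<alpha> k' \<le> V" using mix k k' by blast
    then have "((1 - \<theta>) * \<alpha> k + \<theta> * \<alpha> k') * (\<delta> k' - \<delta> k) \<le> V * (\<delta> k' - \<delta> k)"
      using d by (intro mult_right_mono) auto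
    moreover have "((1 - \<theta>) * \<alpha> k + \<theta> * \<alpha> k') * (\<delta> k' - \<delta> k)
      = \<alpha> k * (\<delta> k' - \<delta> k) + (\<theta> * (\<delta> k' - \<delta> k)) * (\<alpha> k' - \<alpha> k)"
      by (simp add: algebra_simps)
    ultimately have "(\<alpha> k' - V) * (\<epsilon> - \<delta> k) \<le> (V - \<alpha> k) * (\<delta> k' - \<epsilon>)"
      unfolding \<theta> by (simp add: algebra_simps)
    then show ?thesis using k k' by (simp add: k'(3) field_simps)
  qed
  \<comment> \<open>The strictly cheaper point \<open>k0\<close> supplies the upper bound on the
    slopes.\<close>
  have bdd: "bdd_above S" using bound slater by (intro bdd_aboveI) blast
  have ne: "0 \<in> S" by (simp add: S_def)
  define \<rho> where "\<rho> = Sup S"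
  have "\<alpha> k - \<rho> * (\<delta> k - \<epsilon>) \<le> V" if "k \<in> K" for k
  proof -
    consider "\<delta> k < \<epsilon>" | "\<delta> k = \<epsilon>" | "\<epsilon> < \<delta> k" by linarith
    then show ?thesis
    proof cases
      case 1
      then have "\<rho> \<le> (V - \<alpha> k) / (\<epsilon> - \<delta> k)"
        using bound that ne unfolding \<rho>_def by (intro cSup_least) auto
      then have "\<rho> * (\<epsilon> - \<delta> k) \<le> V - \<alpha> k" using 1 by (simp add: pos_le_divide_eq)
      then show ?thesis by (simp add: algebra_simps)
    next
      case 2
      then show ?thesis using single that by simp
    next
      case 3
      then have "(\<alpha> k - V) / (\<delta> k - \<epsilon>) \<le> \<rho>"
        using that bdd unfolding \<rho>_def by (intro cSup_upper) (auto simp: S_def)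
      then show ?thesis using 3 by (simp add: pos_divide_le_eq algebra_simps)
    qed
  qed
  moreover have "0 \<le> \<rho>" unfolding \<rho>_def using ne bdd by (rule cSup_upper)
  ultimately show ?thesis using that by blast
qed

section \<open>Three-point maxima and McCormick envelopes at binary points\<close>

definition max3 :: "real \<Rightarrow> real \<Rightarrow> real \<Rightarrow> real \<Rightarrow> real \<Rightarrow> real" where
  "max3 c \<rho> lo mid hi = max (c * lo - \<rho> * (mid - lo)) (max (c * mid) (c * hi - \<rho> * (hi - mid)))"

lemma above_three_iff: "above_three z c \<rho> lo mid hi \<longleftrightarrow> max3 c \<rho> lo mid hi \<le> z"
  by (auto simp: above_three_def max3_def)

text \<open>The function is affine on each side of \<open>mid\<close>, with slope
  \<open>c + \<rho>\<close> on the left and \<open>c - \<rho>\<close> on the right. Whatever the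
  sign of the slope, an end point of the piece is at least as good.\<close>

lemma max3_upper:
  assumes "lo \<le> s" "s \<le> hi"
  shows "c * s - \<rho> * \<bar>s - mid\<bar> \<le> max3 c \<rho> lo mid hi"
proof -
  have "(c + \<rho>) * s \<le> max ((c + \<rho>) * lo) ((c + \<rho>) * mid)" if "s \<le> mid"
    using that assms by (cases "c + \<rho> \<ge> 0") (auto simp: le_max_iff_disj mult_left_mono mult_left_mono_neg)
  moreover have "(c - \<rho>) * s \<le> max ((c - \<rho>) * mid) ((c - \<rho>) * hi)" if "mid \<le> s"
    using that assms by (cases "c - \<rho> \<ge> 0") (auto simp: le_max_iff_disj mult_left_mono mult_left_mono_neg)
  ultimately show ?thesis
    by (cases "s \<le> mid") (auto simp: max3_def algebra_simps le_max_iff_disj)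
qed

lemma max3_attained:
  assumes "lo \<le> mid" "mid \<le> hi"
  obtains s where "lo \<le> s" "s \<le> hi" "max3 c \<rho> lo mid hi = c * s - \<rho> * \<bar>s - mid\<bar>"
proof -
  have "\<exists>s\<in>{lo, mid, hi}. max3 c \<rho> lo mid hi = c * s - \<rho> * \<bar>s - mid\<bar>"
    using assms by (auto simp: max3_def max_def)
  then show ?thesis using that assms order_trans[OF assms] by blast
qed

lemma max3_zero:
  assumes "0 \<le> \<rho>" "lo \<le> mid" "mid \<le> hi"
  shows "max3 0 \<rho> lo mid hi = 0"
proof -
  have "0 \<le> \<rho> * (mid - lo)" "0 \<le> \<rho> * (hi - mid)" using assms by auto
  then show ?thesis by (simp add: max3_def)
qed

text \<open>These are the constants of the McCormick inequalities. They have to enclose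
  \<open>max3\<close>, since McCormick bounds restrict the factor even when the binary variable is
  0.\<close>

lemma max3_bounds:
  assumes "0 \<le> \<rho>" "lo \<le> mid" "mid \<le> hi"
  shows "c * mid \<le> max3 c \<rho> lo mid hi" "max3 c \<rho> lo mid hi \<le> max (c * lo) (c * hi)"
proof -
  show "c * mid \<le> max3 c \<rho> lo mid hi" by (simp add: max3_def)
  have "c * mid \<le> max (c * lo) (c * hi)"
    using assms by (cases "c \<ge> 0") (auto simp: le_max_iff_disj mult_left_mono mult_left_mono_neg)
  moreover have "0 \<le> \<rho> * (mid - lo)" "0 \<le> \<rho> * (hi - mid)" using assms by auto
  ultimately show "max3 c \<rho> lo mid hi \<le> max (c * lo) (c * hi)"
    by (auto simp: max3_def)
qed

lemma binary_sum_le_one_cases: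
  fixes b :: "'j \<Rightarrow> real"
  assumes "finite A" "\<forall>j\<in>A. b j \<in> {0, 1}" "sum b A \<le> 1"
  obtains "\<forall>j\<in>A. b j = 0" | k where "k \<in> A" "b k = 1" "\<forall>j\<in>A - {k}. b j = 0"
proof (cases "\<exists>k\<in>A. b k = 1")
  case True
  then obtain k where k: "k \<in> A" "b k = 1" by blast
  have nn: "0 \<le> b j" if "j \<in> A" for j using assms(2) that by auto
  have "sum b (A - {k}) \<le> 0" using assms(1,3) k by (simp add: sum.remove)
  then have "sum b (A - {k}) = 0" using nn by (intro antisym sum_nonneg) auto
  then have "\<forall>j\<in>A - {k}. b j = 0"
    using assms(1) nn by (subst (asm) sum_nonneg_eq_0_iff) auto
  then show ?thesis using that(2) k by blast
next
  case False
  then show ?thesis using that(1) assms(2) by blast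
qed

text \<open>At most one term of the sum survives, so the nonlinear \<open>max3\<close> passes
  through it; when none survives, both sides are 0 by \<open>max3_zero\<close>. This turns a maximum
  per scenario coordinate into maxima per position.\<close>

lemma max3_binary_sum:
  fixes b :: "'j \<Rightarrow> real"
  assumes "finite A" "\<forall>j\<in>A. b j \<in> {0, 1}" "sum b A \<le> 1"
    and "0 \<le> \<rho>" "lo \<le> mid" "mid \<le> hi"
  shows "(\<Sum>j\<in>A. max3 (c j) \<rho> lo mid hi * b j) = max3 (\<Sum>j\<in>A. c j * b j) \<rho> lo mid hi"
  using assms(1-3)
proof (cases rule: binary_sum_le_one_cases)
  case 1
  then show ?thesis using max3_zero[OF assms(4-6)] by simp
next
  case (2 k)
  have "(\<Sum>j\<in>A. h j * b j) = h k" for h :: "'j \<Rightarrow> real"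
    using 2 sum.remove[OF assms(1) 2(1), of "\<lambda>j. h j * b j"] by simp
  then show ?thesis by simp
qed

text \<open>The envelope is exact at binary points: two of the four inequalities force the product,
  the other two confine \<open>y\<close> to \<open>[lo, hi]\<close>.\<close>

lemma mccormick_binary:
  assumes "b \<in> {0, 1}"
  shows "mccormick lo hi y b z \<longleftrightarrow> z = y * b \<and> lo \<le> y \<and> y \<le> hi"
  using assms by (auto simp: mccormick_def)

lemma mccormick_max3:
  assumes "b \<in> {0, 1}" "0 \<le> \<rho>" "lo \<le> mid" "mid \<le> hi"
  shows "mccormick (c * mid) (max (c * lo) (c * hi)) (max3 c \<rho> lo mid hi) b
    (max3 c \<rho> lo mid hi * b)"
  using mccormick_binary[OF assms(1)] max3_bounds[OF assms(2-4)] by simp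

section \<open>Summation by parts and the waiting-time recursion\<close>

lemma sum_by_parts:
  fixes w y :: "nat \<Rightarrow> real"
  shows "(\<Sum>j=1..n. (w j - w (j - 1)) * y j) =
    (\<Sum>j=1..n. w j * (y j - y (Suc j))) + w n * y (Suc n) - w 0 * y 1"
  by (induction n) (auto simp: algebra_simps)

text \<open>The Lindley recursion: waiting times when everyone is served as early as possible,
  \<open>b j\<close> being the right-hand side of the \<open>j\<close>-th constraint. The initial 0
  gives the first constraint the form of the others.\<close>

primrec wait :: "(nat \<Rightarrow> real) \<Rightarrow> nat \<Rightarrow> real" where
  "wait b 0 = 0"
| "wait b (Suc j) = max 0 (wait b j + b (Suc j))"

definition idle :: "(nat \<Rightarrow> real) \<Rightarrow> nat \<Rightarrow> real" where
  "idle b j = max 0 (- (wait b (j - 1) + b j))"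

lemma wait_nonneg: "0 \<le> wait b j"
  by (cases j) auto

lemma idle_nonneg: "0 \<le> idle b j"
  by (simp add: idle_def)

lemma wait_idle: "1 \<le> j \<Longrightarrow> wait b j - wait b (j - 1) - idle b j = b j"
  by (cases j) (auto simp: idle_def)

lemma idle_complementary: "1 \<le> j \<Longrightarrow> wait b j = 0 \<or> idle b j = 0"
  by (cases j) (auto simp: idle_def)

subsection \<open>The second-stage program\<close>

locale dhras_instance =
  fixes P :: dhras
  assumes ncust_pos: "1 \<le> ncust P"
    and unit_costs: "\<forall>j\<in>{1..ncust P}. 0 \<le> cw P j \<and> 0 \<le> cu P j"
    and co_nonneg: "0 \<le> co P" and lam_nonneg: "0 \<le> lam P"
    and cost_condition: "\<forall>j\<in>{1..<ncust P}. cu P (j + 1) \<le> cu P j + cw P j"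
    and tlo_nonneg: "\<forall>c\<in>arcs P. 0 \<le> tlo P c" and dlo_nonneg: "\<forall>i\<in>{1..ncust P}. 0 \<le> dlo P i"
    and nsamp_pos: "1 \<le> nsamp P"
    and samples: "\<forall>r\<in>{1..nsamp P}. samp P r \<in> support P"
    and eps_pos: "0 < eps P"
begin

abbreviation N :: nat where "N \<equiv> ncust P"

text \<open>Extending a block from \<open>v\<close> to \<open>Suc v\<close> changes
  \<open>dpi\<close> by \<open>cuext P v + cwext P v - cuext P (Suc v)\<close>. This is nonnegative
  by the cost condition for \<open>v < N\<close>, and beyond that because \<open>cuext\<close>
  vanishes after \<open>N\<close>.\<close>

lemma dpi_lower:
  assumes "1 \<le> j" "j \<le> v" "v \<le> N + 2"
  shows "- cuext P j \<le> dpi P j v"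
  using assms(2,3)
proof (induction rule: dec_induct)
  case base
  show ?case by (simp add: dpi_def)
next
  case (step v)
  have "cuext P (Suc v) \<le> cuext P v + cwext P v"
  proof -
    consider "v < N" | "v = N" | "v = Suc N" using step by linarith
    then show ?thesis
      using cost_condition unit_costs co_nonneg ncust_pos assms step.hyps
      by cases (auto simp: cuext_def cwext_def)
  qed
  moreover have "dpi P j (Suc v) = dpi P j v + cuext P v + cwext P v - cuext P (Suc v)"
    using step.hyps by (simp add: dpi_def)
  ultimately show ?case using step by simp
qed

lemma dpi_Suc: "j < v \<Longrightarrow> dpi P j v = cwext P j + dpi P (Suc j) v"
  by (simp add: dpi_def sum.atLeast_Suc_lessThan)

lemma dpi_last: "dpi P (N + 2) (N + 2) = 0"
  by (simp add: dpi_def cuext_def)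

text \<open>The conventions for \<open>a\<^bsub>N+1\<^esub>\<close> and \<open>x\<^bsub>i,N+1\<^esub>\<close> cover the last constraint of the second-stage program.\<close>

definition rhs where
  "rhs x a \<xi> j = (if j = 1 then (\<Sum>i=1..N. trav \<xi> 0 i * x i 1) - a 1
     else aext P a (j - 1) - aext P a j + (\<Sum>i=1..N. serv \<xi> i * x i (j - 1))
       + (\<Sum>i=1..N. \<Sum>i'\<in>{1..N} - {i}. trav \<xi> i i' * x i (j - 1) * xext P x i' j))"

lemma lp_feasible_iff:
  assumes "w 0 = 0"
  shows "lp_feasible P x a \<xi> w u \<longleftrightarrow> (\<forall>j\<in>{1..N + 1}. 0 \<le> w j \<and> 0 \<le> u j) \<and>
    (\<forall>j\<in>{1..N + 1}. w j - w (j - 1) - u j = rhs x a \<xi> j)"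
proof -
  have "{1..N + 1} = insert 1 (insert (N + 1) {2..N})" using ncust_pos by auto
  moreover have "rhs x a \<xi> (N + 1) = a N - aext P a (N + 1) + (\<Sum>i=1..N. serv \<xi> i * x i N)"
    using ncust_pos by (simp add: rhs_def xext_def aext_def)
  moreover have "rhs x a \<xi> j = a (j - 1) - a j + (\<Sum>i=1..N. serv \<xi> i * x i (j - 1))
      + travel_between P x \<xi> j" if "j \<in> {2..N}" for j
    using that by (auto simp: rhs_def aext_def xext_def travel_between_def)
  moreover have "rhs x a \<xi> 1 = (\<Sum>i=1..N. trav \<xi> 0 i * x i 1) - a 1"
    by (simp add: rhs_def)
  ultimately show ?thesis
    using assms unfolding lp_feasible_def by auto
qed

lemma lp_objective_eq:
  "lp_objective P x \<xi> w u = (\<Sum>j=1..N + 1. cwext P j * w j + cuext P j * u j)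
     + lam P * total_travel P x \<xi>"
  by (simp add: lp_objective_def cwext_def cuext_def)

text \<open>The program never reads \<open>w 0\<close>, so any feasible point may be normalized to
  \<open>w 0 = 0\<close>, as summation by parts requires.\<close>

lemma lp_change_0:
  "lp_feasible P x a \<xi> (w(0 := 0)) u = lp_feasible P x a \<xi> w u"
  "lp_objective P x \<xi> (w(0 := 0)) u = lp_objective P x \<xi> w u"
  using ncust_pos by (auto simp: lp_feasible_def lp_objective_def)

text \<open>The objective of the linear-programming dual at the point \<open>dpi P j (e j)\<close>,
  with the travel cost, which is constant in the second stage, carried along.\<close>

definition dual_value where
  "dual_value x a e \<xi> =
     (\<Sum>j=1..N + 1. rhs x a \<xi> j * dpi P j (e j)) + lam P * total_travel P x \<xi>"

text \<open>The duality gap as a sum of primal variables times dual slacks. Summation by parts moves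
  the differences from \<open>w\<close> to the dual point.\<close>

lemma dual_gap:
  assumes "w 0 = 0" "\<forall>j\<in>{1..N + 1}. w j - w (j - 1) - u j = rhs x a \<xi> j"
    and "block_ends (N + 2) e"
  shows "lp_objective P x \<xi> w u - dual_value x a e \<xi> =
    (\<Sum>j=1..N + 1. w j * (cwext P j - (dpi P j (e j) - dpi P (Suc j) (e (Suc j))))
      + u j * (cuext P j + dpi P j (e j)))"
proof -
  define y where "y j = dpi P j (e j)" for j
  \<comment> \<open>The last interval ends in \<open>N + 2\<close>, where the dual value is 0; this
    removes the boundary term.\<close>
  have "y (Suc (N + 1)) = 0"
    using assms(3) dpi_last by (simp add: y_def block_ends_def)
  then have parts: "(\<Sum>j=1..N + 1. (w j - w (j - 1)) * y j)
      = (\<Sum>j=1..N + 1. w j * (y j - y (Suc j)))"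
    using sum_by_parts[of w y "N + 1"] assms(1) by simp
  have "(\<Sum>j=1..N + 1. rhs x a \<xi> j * y j) = (\<Sum>j=1..N + 1. (w j - w (j - 1)) * y j - u j * y j)"
    using assms(2) by (intro sum.cong refl) (simp flip: left_diff_distrib)
  also have "\<dots> = (\<Sum>j=1..N + 1. w j * (y j - y (Suc j)) - u j * y j)"
    using parts by (simp only: sum_subtractf)
  finally show ?thesis
    unfolding lp_objective_eq dual_value_def y_def[symmetric]
    by (simp only: add_diff_add diff_self add_0_right flip: sum_subtractf)
       (intro sum.cong refl, simp add: algebra_simps)
qed

text \<open>If \<open>j\<close> closes its block, its dual value is \<open>- cuext P j\<close> and
  \<open>dpi_lower\<close> bounds the next one from below. If \<open>j\<close> is tied to
  \<open>Suc j\<close>, the first constraint holds with equality.\<close>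

lemma dual_feasible:
  assumes e: "block_ends (N + 2) e" and j: "j \<in> {1..N + 1}"
  shows "dpi P j (e j) - dpi P (Suc j) (e (Suc j)) \<le> cwext P j" "- cuext P j \<le> dpi P j (e j)"
proof -
  have bounds: "j \<le> e j" "e j \<le> N + 2" "Suc j \<le> e (Suc j)" "e (Suc j) \<le> N + 2"
    using block_ends_bounds[OF e, of j] block_ends_bounds[OF e, of "Suc j"] j by auto
  show "- cuext P j \<le> dpi P j (e j)" using dpi_lower bounds j by simp
  have "j < N + 2" using j by simp
  then consider "e j = j" | "e j = e (Suc j)" using e unfolding block_ends_def by blast
  then show "dpi P j (e j) - dpi P (Suc j) (e (Suc j)) \<le> cwext P j"
  proof cases
    case 1
    have "- cuext P (Suc j) \<le> dpi P (Suc j) (e (Suc j))" using bounds by (intro dpi_lower) auto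
    moreover have "- cuext P j \<le> dpi P j (Suc j)" using j by (intro dpi_lower) auto
    ultimately show ?thesis using 1 by (simp add: dpi_def)
  next
    case 2
    then show ?thesis using bounds dpi_Suc[of j "e j"] by simp
  qed
qed

lemma dual_value_le_objective:
  assumes "lp_feasible P x a \<xi> w u" "block_ends (N + 2) e"
  shows "dual_value x a e \<xi> \<le> lp_objective P x \<xi> w u"
proof -
  define w' where "w' = w(0 := 0)"
  have w0: "w' 0 = 0" and f: "lp_feasible P x a \<xi> w' u"
    and obj: "lp_objective P x \<xi> w' u = lp_objective P x \<xi> w u"
    using assms(1) lp_change_0 by (auto simp: w'_def)
  note f = f[unfolded lp_feasible_iff[where w = w', OF w0]]
  have "0 \<le> lp_objective P x \<xi> w' u - dual_value x a e \<xi>"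
    unfolding dual_gap[OF w0 conjunct2[OF f] assms(2)]
  proof (rule sum_nonneg)
    fix j assume j: "j \<in> {1..N + 1}"
    show "0 \<le> w' j * (cwext P j - (dpi P j (e j) - dpi P (Suc j) (e (Suc j))))
        + u j * (cuext P j + dpi P j (e j))"
      using f j dual_feasible[OF assms(2) j]
      by (intro add_nonneg_nonneg[OF mult_nonneg_nonneg mult_nonneg_nonneg]) auto
  qed
  then show ?thesis using obj by simp
qed

abbreviation greedy_value where
  "greedy_value x a \<xi> \<equiv> lp_objective P x \<xi> (wait (rhs x a \<xi>)) (idle (rhs x a \<xi>))"

lemma greedy_feasible: "lp_feasible P x a \<xi> (wait (rhs x a \<xi>)) (idle (rhs x a \<xi>))"
  by (subst lp_feasible_iff) (auto simp: wait_nonneg idle_nonneg wait_idle[unfolded One_nat_def])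

text \<open>The optimal dual point ties \<open>j\<close> to \<open>j + 1\<close> exactly when customer \<open>j\<close> waits.\<close>

lemma greedy_dual:
  obtains e where "block_ends (N + 2) e" "greedy_value x a \<xi> = dual_value x a e \<xi>"
proof -
  let ?w = "wait (rhs x a \<xi>)" and ?u = "idle (rhs x a \<xi>)"
  obtain e where e: "block_ends (N + 2) e"
    and tied: "\<forall>j<N + 2. e j = (if ?w j > 0 then e (Suc j) else j)"
    using block_ends_exist[of "N + 2" "\<lambda>j. ?w j > 0"] by blast
  \<comment> \<open>If \<open>j\<close> waits, its idle time is 0 and the tie makes the first slack
    vanish. If not, the waiting time is 0 and the block ending in \<open>j\<close> makes the second
    slack vanish.\<close>
  have "?w j * (cwext P j - (dpi P j (e j) - dpi P (Suc j) (e (Suc j))))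
      + ?u j * (cuext P j + dpi P j (e j)) = 0" if j: "j \<in> {1..N + 1}" for j
  proof (cases "?w j > 0")
    case True
    then have "?u j = 0" using idle_complementary[of j] j by force
    moreover have "e j = e (Suc j)" using tied True j by auto
    moreover have "Suc j \<le> e (Suc j)" using block_ends_bounds[OF e, of "Suc j"] j by auto
    ultimately show ?thesis using dpi_Suc[of j "e j"] by simp
  next
    case False
    then have "e j = j" using tied j by auto
    moreover have "?w j = 0" using False wait_nonneg by (metis not_less antisym)
    ultimately show ?thesis by (simp add: dpi_def)
  qed
  then have "greedy_value x a \<xi> - dual_value x a e \<xi> = 0"
    by (subst dual_gap[OF _ _ e]) (auto simp: wait_idle[unfolded One_nat_def] intro!: sum.neutral)
  then show ?thesis using that e by simp
qed

lemma second_stage_lower: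
  assumes "\<And>w u. lp_feasible P x a \<xi> w u \<Longrightarrow> c \<le> lp_objective P x \<xi> w u"
  shows "c \<le> second_stage P x a \<xi>"
  unfolding second_stage_def using assms greedy_feasible by (intro cInf_greatest) blast+

lemma dual_value_le_second_stage:
  "block_ends (N + 2) e \<Longrightarrow> dual_value x a e \<xi> \<le> second_stage P x a \<xi>"
  by (intro second_stage_lower dual_value_le_objective)

text \<open>The greedy point has a dual point of equal value. The resulting closed form also gives
  measurability in the scenario.\<close>

lemma second_stage_greedy: "second_stage P x a \<xi> = greedy_value x a \<xi>"
proof (rule antisym)
  obtain e where e: "block_ends (N + 2) e" "greedy_value x a \<xi> = dual_value x a e \<xi>"
    by (rule greedy_dual)
  show "greedy_value x a \<xi> \<le> second_stage P x a \<xi>"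
    using dual_value_le_second_stage e by simp
  show "second_stage P x a \<xi> \<le> greedy_value x a \<xi>"
    unfolding second_stage_def
    using greedy_feasible dual_value_le_objective[OF _ e(1)]
    by (intro cInf_lower bdd_belowI[of _ "dual_value x a e \<xi>"]) blast+
qed

lemma second_stage_attained:
  obtains e where "block_ends (N + 2) e" "second_stage P x a \<xi> = dual_value x a e \<xi>"
  using greedy_dual[of x \<xi> a] unfolding second_stage_greedy by blast

section \<open>Bounds on the support and sign of the second-stage value\<close>

lemma support_bounds:
  assumes "\<xi> \<in> support P"
  shows "e \<in> arcs P \<Longrightarrow> 0 \<le> fst \<xi> e" "e \<in> arcs P \<Longrightarrow> tlo P e \<le> fst \<xi> e"
    "e \<in> arcs P \<Longrightarrow> fst \<xi> e \<le> thi P e"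
    "i \<in> {1..N} \<Longrightarrow> 0 \<le> snd \<xi> i" "i \<in> {1..N} \<Longrightarrow> dlo P i \<le> snd \<xi> i"
    "i \<in> {1..N} \<Longrightarrow> snd \<xi> i \<le> dhi P i"
  using assms by (auto simp: support_def)

lemma assignments_binary:
  assumes "x \<in> assignments P" "i \<in> {1..N}" "j \<in> {1..N}"
  shows "x i j \<in> {0, 1}"
  using assms unfolding assignments_def by (blast dest: PiE_mem)

lemma arcs_iff [simp]: "(i, i') \<in> arcs P \<longleftrightarrow> i \<le> N \<and> i' \<le> N \<and> i \<noteq> i'"
  by (simp add: arcs_def)

text \<open>All costs, assignment entries and travel times are nonnegative. In weak duality this
  makes the integrable majorant of the second-stage value nonnegative.\<close>

lemma second_stage_nonneg:
  assumes x: "x \<in> assignments P" and "\<xi> \<in> support P"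
  shows "0 \<le> second_stage P x a \<xi>"
proof (rule second_stage_lower)
  fix w u
  assume f: "lp_feasible P x a \<xi> w u"
  have x0: "0 \<le> x i j" if "i \<in> {1..N}" "j \<in> {1..N}" for i j
    using assignments_binary[OF x that] by auto
  have t0: "0 \<le> trav \<xi> i i'" if "i \<le> N" "i' \<le> N" "i \<noteq> i'" for i i'
    using support_bounds(1)[OF assms(2), of "(i, i')"] that by simp
  have "0 \<le> total_travel P x \<xi>"
    unfolding total_travel_def travel_between_def
    by (intro add_nonneg_nonneg sum_nonneg mult_nonneg_nonneg x0 t0) (use ncust_pos in auto)
  then show "0 \<le> lp_objective P x \<xi> w u"
    using f unit_costs co_nonneg lam_nonneg unfolding lp_feasible_def lp_objective_def
    by (intro add_nonneg_nonneg sum_nonneg mult_nonneg_nonneg) auto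
qed

subsection \<open>Transport-penalized dual values\<close>

text \<open>
  The dual value is affine in the scenario; these are its coefficients at the travel times from
  the depot, between customers and to the depot, and at the service times.
\<close>

definition coef_const where
  "coef_const a e = - a 1 * dpi P 1 (e 1)
     + (\<Sum>j=2..N + 1. (aext P a (j - 1) - aext P a j) * dpi P j (e j))"

definition coef_dep where
  "coef_dep x e i = (dpi P 1 (e 1) + lam P) * x i 1"

definition coef_link where
  "coef_link x e i i' =
     (\<Sum>j=2..N + 1. (dpi P j (e j) + lam P) * (x i (j - 1) * xext P x i' j))"

definition coef_ret where
  "coef_ret x i = lam P * x i N"

definition coef_serv where
  "coef_serv x e i = (\<Sum>j=2..N + 1. dpi P j (e j) * x i (j - 1))"

definition arc_coef where
  "arc_coef x e = (\<lambda>(i, i'). if i = 0 then coef_dep x e i' else if i' = 0 then coef_ret x i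
     else coef_link x e i i')"

lemma sum_arcs:
  fixes f :: "nat \<times> nat \<Rightarrow> real"
  shows "(\<Sum>e\<in>arcs P. f e) = (\<Sum>i=1..N. f (0, i)) + (\<Sum>i=1..N. f (i, 0))
    + (\<Sum>i=1..N. \<Sum>i'\<in>{1..N} - {i}. f (i, i'))"
proof -
  have 1: "(\<Sum>i=1..N. f (0, i)) = sum f (Pair 0 ` {1..N})"
    by (subst sum.reindex) (auto simp: inj_on_def)
  have 2: "(\<Sum>i=1..N. f (i, 0)) = sum f ((\<lambda>i. (i, 0)) ` {1..N})"
    by (subst sum.reindex) (auto simp: inj_on_def)
  have 3: "(\<Sum>i=1..N. \<Sum>i'\<in>{1..N} - {i}. f (i, i')) = sum f (SIGMA i:{1..N}. {1..N} - {i})"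
    by (subst sum.Sigma) (auto simp: case_prod_unfold)
  have "arcs P = Pair 0 ` {1..N} \<union> (\<lambda>i. (i, 0)) ` {1..N} \<union> (SIGMA i:{1..N}. {1..N} - {i})"
    by (auto simp: arcs_def)
  then have "sum f (arcs P)
      = sum f (Pair 0 ` {1..N} \<union> (\<lambda>i. (i, 0)) ` {1..N} \<union> (SIGMA i:{1..N}. {1..N} - {i}))"
    by (rule arg_cong)
  also have "\<dots> = sum f (Pair 0 ` {1..N} \<union> (\<lambda>i. (i, 0)) ` {1..N})
      + sum f (SIGMA i:{1..N}. {1..N} - {i})"
    by (rule sum.union_disjoint) auto
  also have "sum f (Pair 0 ` {1..N} \<union> (\<lambda>i. (i, 0)) ` {1..N})
      = sum f (Pair 0 ` {1..N}) + sum f ((\<lambda>i. (i, 0)) ` {1..N})"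
    by (intro sum.union_disjoint) auto
  finally show ?thesis unfolding 1 2 3 .
qed

lemma sum_arcs_arc_coef:
  fixes h :: "real \<Rightarrow> nat \<times> nat \<Rightarrow> real"
  shows "(\<Sum>c\<in>arcs P. h (arc_coef x e c) c) = (\<Sum>i=1..N. h (coef_dep x e i) (0, i))
    + (\<Sum>i=1..N. h (coef_ret x i) (i, 0))
    + (\<Sum>i=1..N. \<Sum>i'\<in>{1..N} - {i}. h (coef_link x e i i') (i, i'))"
  unfolding sum_arcs
  by (intro arg_cong2[of _ _ _ _ "(+)"] sum.cong refl) (auto simp: arc_coef_def)

lemma sum_split_first:
  fixes f :: "nat \<Rightarrow> real"
  shows "(\<Sum>j=1..N + 1. f j) = f 1 + (\<Sum>j=2..N + 1. f j)"
  by (subst sum.atLeast_Suc_atMost) (auto simp: numeral_2_eq_2)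

lemma sum_link_swap:
  fixes f :: "nat \<Rightarrow> nat \<Rightarrow> nat \<Rightarrow> real"
  shows "(\<Sum>j\<in>J. \<Sum>i=1..N. \<Sum>i'\<in>{1..N} - {i}. f i i' j)
    = (\<Sum>i=1..N. \<Sum>i'\<in>{1..N} - {i}. \<Sum>j\<in>J. f i i' j)"
proof -
  have "(\<Sum>j\<in>J. \<Sum>i'\<in>{1..N} - {i}. f i i' j) = (\<Sum>i'\<in>{1..N} - {i}. \<Sum>j\<in>J. f i i' j)" for i
    by (rule sum.swap)
  then show ?thesis by (subst sum.swap) simp
qed

lemma dual_value_affine:
  "dual_value x a e \<xi> = coef_const a e + (\<Sum>c\<in>arcs P. arc_coef x e c * fst \<xi> c)
     + (\<Sum>i=1..N. coef_serv x e i * snd \<xi> i)"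
proof -
  let ?\<pi> = "\<lambda>j. dpi P j (e j)"
  have travel: "total_travel P x \<xi> = (\<Sum>i=1..N. trav \<xi> 0 i * x i 1) + (\<Sum>i=1..N. trav \<xi> i 0 * x i N)
      + (\<Sum>j=2..N + 1. \<Sum>i=1..N. \<Sum>i'\<in>{1..N} - {i}. trav \<xi> i i' * x i (j - 1) * xext P x i' j)"
  proof -
    \<comment> \<open>The summand at \<open>N + 1\<close> is 0 because \<open>xext\<close> vanishes
      there, so travel costs can be summed over the same positions as the right-hand sides.\<close>
    have "(\<Sum>j=2..N. h j) + h (N + 1) = (\<Sum>j=2..N + 1. h j)" for h :: "nat \<Rightarrow> real"
      using ncust_pos by simp
    from this[of "\<lambda>j. \<Sum>i=1..N. \<Sum>i'\<in>{1..N} - {i}. trav \<xi> i i' * x i (j - 1) * xext P x i' j"]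
    have "(\<Sum>j=2..N. travel_between P x \<xi> j) = (\<Sum>j=2..N + 1. \<Sum>i=1..N. \<Sum>i'\<in>{1..N} - {i}.
        trav \<xi> i i' * x i (j - 1) * xext P x i' j)"
      by (simp add: travel_between_def xext_def)
    then show ?thesis by (simp add: total_travel_def sum.distrib)
  qed
  have link: "(\<Sum>j=2..N + 1. \<Sum>i=1..N. \<Sum>i'\<in>{1..N} - {i}. trav \<xi> i i' * x i (j - 1) * xext P x i' j * ?\<pi> j)
      + lam P * (\<Sum>j=2..N + 1. \<Sum>i=1..N. \<Sum>i'\<in>{1..N} - {i}. trav \<xi> i i' * x i (j - 1) * xext P x i' j)
      = (\<Sum>i=1..N. \<Sum>i'\<in>{1..N} - {i}. coef_link x e i i' * trav \<xi> i i')"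
    unfolding sum_link_swap coef_link_def sum_distrib_left sum_distrib_right sum.distrib[symmetric]
    by (intro sum.cong refl) (simp add: algebra_simps)
  have serv: "(\<Sum>j=2..N + 1. \<Sum>i=1..N. serv \<xi> i * x i (j - 1) * ?\<pi> j)
      = (\<Sum>i=1..N. coef_serv x e i * snd \<xi> i)"
    unfolding coef_serv_def sum_distrib_right
    by (subst sum.swap, intro sum.cong refl) (simp add: algebra_simps)
  have dep: "(\<Sum>i=1..N. trav \<xi> 0 i * x i 1) * ?\<pi> 1 + lam P * (\<Sum>i=1..N. trav \<xi> 0 i * x i 1)
      = (\<Sum>i=1..N. coef_dep x e i * trav \<xi> 0 i)"
    unfolding coef_dep_def sum_distrib_left sum_distrib_right sum.distrib[symmetric]
    by (intro sum.cong refl) (simp add: algebra_simps)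
  have ret: "lam P * (\<Sum>i=1..N. trav \<xi> i 0 * x i N) = (\<Sum>i=1..N. coef_ret x i * trav \<xi> i 0)"
    unfolding coef_ret_def sum_distrib_left by (intro sum.cong refl) (simp add: algebra_simps)
  have split: "(\<Sum>j=1..N + 1. rhs x a \<xi> j * ?\<pi> j) = rhs x a \<xi> 1 * ?\<pi> 1 + (\<Sum>j=2..N + 1. rhs x a \<xi> j * ?\<pi> j)"
    by (rule sum_split_first)
  have later: "(\<Sum>j=2..N + 1. rhs x a \<xi> j * ?\<pi> j)
      = (\<Sum>j=2..N + 1. (aext P a (j - 1) - aext P a j) * ?\<pi> j)
      + (\<Sum>j=2..N + 1. \<Sum>i=1..N. serv \<xi> i * x i (j - 1) * ?\<pi> j)
      + (\<Sum>j=2..N + 1. \<Sum>i=1..N. \<Sum>i'\<in>{1..N} - {i}. trav \<xi> i i' * x i (j - 1) * xext P x i' j * ?\<pi> j)"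
    unfolding sum.distrib[symmetric] sum_distrib_right[symmetric]
    by (intro sum.cong refl) (auto simp: rhs_def algebra_simps)
  have first: "rhs x a \<xi> 1 * ?\<pi> 1 = - a 1 * ?\<pi> 1 + (\<Sum>i=1..N. trav \<xi> 0 i * x i 1) * ?\<pi> 1"
    by (simp add: rhs_def algebra_simps)
  have "lam P * total_travel P x \<xi>
      = lam P * (\<Sum>i=1..N. trav \<xi> 0 i * x i 1) + lam P * (\<Sum>i=1..N. trav \<xi> i 0 * x i N)
      + lam P * (\<Sum>j=2..N + 1. \<Sum>i=1..N. \<Sum>i'\<in>{1..N} - {i}. trav \<xi> i i' * x i (j - 1) * xext P x i' j)"
    unfolding travel by (rule distrib_left[THEN trans, OF arg_cong2[of _ _ _ _ "(+)"]], rule distrib_left, rule refl)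
  then show ?thesis
    using serv link dep ret split later first
    unfolding dual_value_def coef_const_def sum_arcs_arc_coef[where h = "\<lambda>c e. c * fst \<xi> e"]
    by linarith
qed

text \<open>The supremum over the support of the dual value minus \<open>\<rho>\<close> times the distance to \<open>\<xi>'\<close>.\<close>

definition penalized where
  "penalized x a \<rho> e \<xi>' = coef_const a e
     + (\<Sum>c\<in>arcs P. max3 (arc_coef x e c) \<rho> (tlo P c) (fst \<xi>' c) (thi P c))
     + (\<Sum>i=1..N. max3 (coef_serv x e i) \<rho> (dlo P i) (snd \<xi>' i) (dhi P i))"

lemma dual_value_minus_dist:
  "dual_value x a e \<xi> - \<rho> * dist1 P \<xi> \<xi>' = coef_const a e
     + (\<Sum>c\<in>arcs P. arc_coef x e c * fst \<xi> c - \<rho> * \<bar>fst \<xi> c - fst \<xi>' c\<bar>)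
     + (\<Sum>i=1..N. coef_serv x e i * snd \<xi> i - \<rho> * \<bar>snd \<xi> i - snd \<xi>' i\<bar>)"
  by (simp add: dual_value_affine dist1_def sum_subtractf distrib_left sum_distrib_left)

text \<open>Both the dual value and the \<open>1\<close>-norm split over coordinates, so each
  coordinate is bounded on its own.\<close>

lemma penalized_upper:
  assumes "\<xi> \<in> support P"
  shows "dual_value x a e \<xi> - \<rho> * dist1 P \<xi> \<xi>' \<le> penalized x a \<rho> e \<xi>'"
  unfolding dual_value_minus_dist penalized_def
  by (intro add_mono sum_mono max3_upper order_refl support_bounds[OF assms])

text \<open>The support is a box, hence coordinatewise maximizers combine to a scenario in
  it.\<close>

lemma penalized_attained:
  assumes \<xi>': "\<xi>' \<in> support P"
  obtains \<xi> where "\<xi> \<in> support P" "penalized x a \<rho> e \<xi>' = dual_value x a e \<xi> - \<rho> * dist1 P \<xi> \<xi>'"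
proof -
  have "\<exists>s. tlo P c \<le> s \<and> s \<le> thi P c \<and> 0 \<le> s \<and> max3 (arc_coef x e c) \<rho> (tlo P c) (fst \<xi>' c) (thi P c)
      = arc_coef x e c * s - \<rho> * \<bar>s - fst \<xi>' c\<bar>" if "c \<in> arcs P" for c
    by (rule max3_attained[OF support_bounds(2,3)[OF \<xi>' that], of "arc_coef x e c" \<rho>],
        intro exI conjI, assumption+, rule order_trans[OF bspec[OF tlo_nonneg that]], assumption+)
  then obtain s where s: "\<And>c. c \<in> arcs P \<Longrightarrow> tlo P c \<le> s c \<and> s c \<le> thi P c \<and> 0 \<le> s c \<and>
      max3 (arc_coef x e c) \<rho> (tlo P c) (fst \<xi>' c) (thi P c)
      = arc_coef x e c * s c - \<rho> * \<bar>s c - fst \<xi>' c\<bar>"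
    by metis
  have "\<exists>d. dlo P i \<le> d \<and> d \<le> dhi P i \<and> 0 \<le> d \<and> max3 (coef_serv x e i) \<rho> (dlo P i) (snd \<xi>' i) (dhi P i)
      = coef_serv x e i * d - \<rho> * \<bar>d - snd \<xi>' i\<bar>" if "i \<in> {1..N}" for i
    by (rule max3_attained[OF support_bounds(5,6)[OF \<xi>' that], of "coef_serv x e i" \<rho>],
        intro exI conjI, assumption+, rule order_trans[OF bspec[OF dlo_nonneg that]], assumption+)
  then obtain d where d: "\<And>i. i \<in> {1..N} \<Longrightarrow> dlo P i \<le> d i \<and> d i \<le> dhi P i \<and> 0 \<le> d i \<and>
      max3 (coef_serv x e i) \<rho> (dlo P i) (snd \<xi>' i) (dhi P i)
      = coef_serv x e i * d i - \<rho> * \<bar>d i - snd \<xi>' i\<bar>"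
    by metis
  \<comment> \<open>Restricting makes the components extensional, as membership in the product space
    demands.\<close>
  define \<xi> where "\<xi> = (restrict s (arcs P), restrict d {1..N})"
  have "\<xi> \<in> support P"
    using s d by (auto simp: support_def \<xi>_def scenario_space_def space_pair_measure space_PiM)
  moreover have "penalized x a \<rho> e \<xi>' = dual_value x a e \<xi> - \<rho> * dist1 P \<xi> \<xi>'"
    unfolding dual_value_minus_dist penalized_def \<xi>_def using s d by simp
  ultimately show ?thesis by (rule that)
qed

subsection \<open>The mixed-integer program for fixed first-stage decisions\<close>

text \<open>
  The weight of position \<open>j\<close> in a block with end \<open>v\<close> when every linearized product takes the
  least value that the program allows for the given \<open>x\<close>.
\<close>

definition stage_bound where
  "stage_bound x a \<rho> \<xi>' j v = (if j = 1 then - a 1 * dpi P 1 v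
       + (\<Sum>i=1..N. max3 (dpi P 1 v + lam P) \<rho> (tlo P (0, i)) (trav \<xi>' 0 i) (thi P (0, i)) * x i 1)
     else if j \<le> N + 1 then (aext P a (j - 1) - aext P a j) * dpi P j v
       + (\<Sum>i=1..N. max3 (dpi P j v) \<rho> (dlo P i) (serv \<xi>' i) (dhi P i) * x i (j - 1))
       + (\<Sum>i=1..N. \<Sum>i'\<in>{1..N} - {i}.
            max3 (dpi P j v + lam P) \<rho> (tlo P (i, i')) (trav \<xi>' i i') (thi P (i, i'))
              * (x i (j - 1) * xext P x i' j))
     else 0)"

text \<open>The counterpart of \<open>stage_bound\<close> in the variables of the program. Position
  \<open>N + 2\<close> weighs 0, which is why the constraints sum only up to
  \<open>min v (N + 1)\<close>.\<close>

definition milp_stage where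
  "milp_stage a y r j v = (if j = 1 then - a 1 * dpi P 1 v + (\<Sum>i=1..N. lin_sigma y r i v)
     else if j \<le> N + 1 then (aext P a (j - 1) - aext P a j) * dpi P j v
       + (\<Sum>i=1..N. lin_zeta y r i j v)
       + (\<Sum>i=1..N. \<Sum>i'\<in>{1..N} - {i}. lin_phi y r i i' j v)
     else 0)"

lemma sum_milp_stage:
  assumes "2 \<le> k" "v \<le> N + 2"
  shows "(\<Sum>j=k..v. milp_stage a y r j v) =
    (\<Sum>j=k..min v (N + 1). (aext P a (j - 1) - aext P a j) * dpi P j v)
    + (\<Sum>j=k..min v (N + 1). \<Sum>i=1..N. lin_zeta y r i j v)
    + (\<Sum>j=k..min v (N + 1). \<Sum>i=1..N. \<Sum>i'\<in>{1..N} - {i}. lin_phi y r i i' j v)"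
proof -
  have "(\<Sum>j=k..v. milp_stage a y r j v) = (\<Sum>j=k..min v (N + 1). milp_stage a y r j v)"
    using assms by (intro sum.mono_neutral_right) (auto simp: milp_stage_def)
  also have "\<dots> = (\<Sum>j=k..min v (N + 1). (aext P a (j - 1) - aext P a j) * dpi P j v
       + (\<Sum>i=1..N. lin_zeta y r i j v)
       + (\<Sum>i=1..N. \<Sum>i'\<in>{1..N} - {i}. lin_phi y r i i' j v))"
    using assms by (intro sum.cong) (auto simp: milp_stage_def)
  finally show ?thesis by (simp only: sum.distrib)
qed

text \<open>The four constraint families form one, indexed by the intervals \<open>{k..v}\<close> of
  \<open>{1..N + 2}\<close>: \<open>{1..1}\<close>, the longer ones starting at 1, those starting in
  \<open>{2..N + 1}\<close>, and \<open>{N + 2..N + 2}\<close>. This is the longest-path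
  form.\<close>

lemma beta_constraints_iff:
  "beta_constraints P a y r \<longleftrightarrow> (\<forall>k v. 1 \<le> k \<and> k \<le> v \<and> v \<le> N + 2 \<longrightarrow>
     (\<Sum>j=k..v. milp_stage a y r j v) \<le> (\<Sum>j=k..v. beta y r j))"
  (is "?L \<longleftrightarrow> (\<forall>k v. ?range k v \<longrightarrow> ?Q k v)")
proof -
  have one: "?Q 1 1 \<longleftrightarrow> beta y r 1 \<ge> - a 1 * dpi P 1 1 + (\<Sum>i=1..N. lin_sigma y r i 1)"
    by (simp add: milp_stage_def)
  have first: "?Q 1 v \<longleftrightarrow> (\<Sum>j=1..v. beta y r j) \<ge> - a 1 * dpi P 1 v
      + (\<Sum>j=2..min v (N + 1). (aext P a (j - 1) - aext P a j) * dpi P j v)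
      + (\<Sum>i=1..N. lin_sigma y r i v)
      + (\<Sum>j=2..min v (N + 1). \<Sum>i=1..N. \<Sum>i'\<in>{1..N} - {i}. lin_phi y r i i' j v)
      + (\<Sum>j=2..min v (N + 1). \<Sum>i=1..N. lin_zeta y r i j v)" if "v \<in> {2..N + 2}" for v
  proof -
    have "(\<Sum>j=1..v. milp_stage a y r j v)
        = milp_stage a y r 1 v + (\<Sum>j=2..v. milp_stage a y r j v)"
      using that by (subst sum.atLeast_Suc_atMost) (auto simp: numeral_2_eq_2)
    moreover have "milp_stage a y r 1 v = - a 1 * dpi P 1 v + (\<Sum>i=1..N. lin_sigma y r i v)"
      by (simp add: milp_stage_def)
    ultimately show ?thesis using sum_milp_stage[of 2 v a y r] that by auto
  qed
  have later: "?Q k v \<longleftrightarrow> (\<Sum>j=k..v. beta y r j) \<ge>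
      (\<Sum>j=k..min v (N + 1). (aext P a (j - 1) - aext P a j) * dpi P j v)
      + (\<Sum>j=k..min v (N + 1). \<Sum>i=1..N. lin_zeta y r i j v)
      + (\<Sum>j=k..min v (N + 1). \<Sum>i=1..N. \<Sum>i'\<in>{1..N} - {i}. lin_phi y r i i' j v)"
    if "k \<in> {2..N + 1}" "v \<in> {k..N + 2}" for k v
    using sum_milp_stage[of k v a y r] that by auto
  have last: "?Q (N + 2) (N + 2) \<longleftrightarrow> beta y r (N + 2) \<ge> 0"
    by (simp add: milp_stage_def)
  have "?L \<longleftrightarrow> ?Q 1 1 \<and> (\<forall>v\<in>{2..N + 2}. ?Q 1 v)
      \<and> (\<forall>k\<in>{2..N + 1}. \<forall>v\<in>{k..N + 2}. ?Q k v) \<and> ?Q (N + 2) (N + 2)"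
    unfolding one last by (simp only: beta_constraints_def first later cong: ball_cong)
  also have "\<dots> \<longleftrightarrow> (\<forall>k v. ?range k v \<longrightarrow> ?Q k v)" (is "?M \<longleftrightarrow> ?R")
  proof
    assume M: ?M
    show ?R
    proof (intro allI impI)
      fix k v assume r: "?range k v"
      consider "k = 1 \<and> v = 1" | "k = 1 \<and> v \<in> {2..N + 2}"
        | "k \<in> {2..N + 1} \<and> v \<in> {k..N + 2}" | "k = N + 2 \<and> v = N + 2"
        using r by (cases "k = 1"; cases "v = 1"; cases "k = N + 2") auto
      then show "?Q k v" using M by cases blast+
    qed
  next
    assume R: ?R
    have Q: "?Q k v" if "1 \<le> k" "k \<le> v" "v \<le> N + 2" for k v using R that by blast
    show ?M by (intro conjI ballI Q) auto
  qed
  finally show ?thesis .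
qed

section \<open>From coordinates to positions\<close>

lemma sum_split_ends:
  fixes f :: "nat \<Rightarrow> real"
  shows "(\<Sum>j=1..N + 2. f j) = f 1 + (\<Sum>j=2..N + 1. f j) + f (N + 2)"
  using sum_split_first[of f] by simp

lemma max3_binary:
  assumes "b \<in> {0, 1 :: real}" "0 \<le> \<rho>" "lo \<le> mid" "mid \<le> hi"
  shows "max3 c \<rho> lo mid hi * b = max3 (c * b) \<rho> lo mid hi"
  using max3_binary_sum[of "{()}" "\<lambda>_. b" \<rho> lo mid hi "\<lambda>_. c"] assms by auto

lemma assignments_succession:
  assumes x: "x \<in> assignments P" and i: "i \<in> {1..N}" "i' \<in> {1..N}" and j: "j \<in> {2..N + 1}"
  shows "x i (j - 1) * xext P x i' j \<in> {0, 1}"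
proof -
  have "x i (j - 1) \<in> {0, 1}" using i j by (intro assignments_binary[OF x]) auto
  moreover have "xext P x i' j \<in> {0, 1}"
    using assignments_binary[OF x i(2), of j] j by (auto simp: xext_def)
  ultimately show ?thesis by auto
qed

lemma assignments_position:
  assumes x: "x \<in> assignments P" and i: "i \<in> {1..N}"
  shows "(\<Sum>j=2..N + 1. x i (j - 1)) = 1"
proof -
  have "(\<Sum>j=2..N + 1. x i (j - 1)) = (\<Sum>j=1..N. x i j)"
    using sum.shift_bounds_cl_Suc_ivl[of "\<lambda>j. x i (j - 1)" 1 N] by (simp add: numeral_2_eq_2)
  then show ?thesis using x i by (simp add: assignments_def)
qed

text \<open>Customer \<open>i\<close> occupies a single position, so \<open>i'\<close> follows it
  directly at most once; \<open>max3_binary_sum\<close> then applies to the arc from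
  \<open>i\<close> to \<open>i'\<close>.\<close>

lemma assignments_succession_sum:
  assumes x: "x \<in> assignments P" and i: "i \<in> {1..N}" "i' \<in> {1..N}"
  shows "(\<Sum>j=2..N + 1. x i (j - 1) * xext P x i' j) \<le> 1"
proof -
  have "x i (j - 1) * xext P x i' j \<le> x i (j - 1)" if j: "j \<in> {2..N + 1}" for j
  proof -
    have "x i (j - 1) \<in> {0, 1}" using i j by (intro assignments_binary[OF x]) auto
    moreover have "xext P x i' j \<in> {0, 1}"
      using assignments_binary[OF x i(2), of j] j by (auto simp: xext_def)
    ultimately show ?thesis by auto
  qed
  then have "(\<Sum>j=2..N + 1. x i (j - 1) * xext P x i' j) \<le> (\<Sum>j=2..N + 1. x i (j - 1))"
    by (rule sum_mono)
  then show ?thesis using assignments_position[OF x i(1)] by simp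
qed

text \<open>Each coordinate maximum is spread over the positions by \<open>max3_binary_sum\<close>
  and then regrouped by position. Return arcs carry the coefficient \<open>lam P\<close> for every
  partition, so they form a separate sum outside the blocks.\<close>

lemma penalized_eq_stages:
  assumes x: "x \<in> assignments P" and \<xi>': "\<xi>' \<in> support P" and \<rho>: "0 \<le> \<rho>"
  shows "penalized x a \<rho> e \<xi>' = (\<Sum>j=1..N + 2. stage_bound x a \<rho> \<xi>' j (e j))
    + (\<Sum>i=1..N. max3 (lam P) \<rho> (tlo P (i, 0)) (trav \<xi>' i 0) (thi P (i, 0)) * x i N)"
proof -
  let ?T = "\<lambda>c i i'. max3 c \<rho> (tlo P (i, i')) (trav \<xi>' i i') (thi P (i, i'))"
  let ?S = "\<lambda>c i. max3 c \<rho> (dlo P i) (serv \<xi>' i) (dhi P i)"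
  note t = support_bounds(2,3)[OF \<xi>'] and d = support_bounds(5,6)[OF \<xi>']
  have dep: "(\<Sum>i=1..N. ?T (dpi P 1 (e 1) + lam P) 0 i * x i 1) = (\<Sum>i=1..N. ?T (coef_dep x e i) 0 i)"
    unfolding coef_dep_def using ncust_pos
    by (intro sum.cong refl max3_binary assignments_binary[OF x] \<rho> t) auto
  have ret: "(\<Sum>i=1..N. ?T (lam P) i 0 * x i N) = (\<Sum>i=1..N. ?T (coef_ret x i) i 0)"
    unfolding coef_ret_def using ncust_pos
    by (intro sum.cong refl max3_binary assignments_binary[OF x] \<rho> t) auto
  have serv: "(\<Sum>j=2..N + 1. \<Sum>i=1..N. ?S (dpi P j (e j)) i * x i (j - 1))
      = (\<Sum>i=1..N. ?S (coef_serv x e i) i)"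
  proof (subst sum.swap, intro sum.cong refl)
    fix i assume i: "i \<in> {1..N}"
    have "x i (j - 1) \<in> {0, 1}" if "j \<in> {2..N + 1}" for j
      using i that by (intro assignments_binary[OF x]) auto
    then show "(\<Sum>j=2..N + 1. ?S (dpi P j (e j)) i * x i (j - 1)) = ?S (coef_serv x e i) i"
      unfolding coef_serv_def using assignments_position[OF x i] d[OF i] \<rho>
      by (intro max3_binary_sum) auto
  qed
  have link: "(\<Sum>j=2..N + 1. \<Sum>i=1..N. \<Sum>i'\<in>{1..N} - {i}.
        ?T (dpi P j (e j) + lam P) i i' * (x i (j - 1) * xext P x i' j))
      = (\<Sum>i=1..N. \<Sum>i'\<in>{1..N} - {i}. ?T (coef_link x e i i') i i')"
    unfolding sum_link_swap
  proof (intro sum.cong refl)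
    fix i i' assume i: "i \<in> {1..N}" "i' \<in> {1..N} - {i}"
    show "(\<Sum>j=2..N + 1. ?T (dpi P j (e j) + lam P) i i' * (x i (j - 1) * xext P x i' j))
        = ?T (coef_link x e i i') i i'"
      unfolding coef_link_def
    proof (intro max3_binary_sum ballI \<rho> t)
      show "x i (j - 1) * xext P x i' j \<in> {0, 1}" if "j \<in> {2..N + 1}" for j
        using assignments_succession[OF x _ _ that] i by blast
      show "(\<Sum>j=2..N + 1. x i (j - 1) * xext P x i' j) \<le> 1"
        using assignments_succession_sum[OF x] i by blast
    qed (use i in auto)
  qed
  have "(\<Sum>j=2..N + 1. stage_bound x a \<rho> \<xi>' j (e j))
      = (\<Sum>j=2..N + 1. (aext P a (j - 1) - aext P a j) * dpi P j (e j))
      + (\<Sum>j=2..N + 1. \<Sum>i=1..N. ?S (dpi P j (e j)) i * x i (j - 1))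
      + (\<Sum>j=2..N + 1. \<Sum>i=1..N. \<Sum>i'\<in>{1..N} - {i}.
          ?T (dpi P j (e j) + lam P) i i' * (x i (j - 1) * xext P x i' j))"
    unfolding sum.distrib[symmetric] by (intro sum.cong refl) (simp add: stage_bound_def)
  moreover have "stage_bound x a \<rho> \<xi>' 1 (e 1)
      = - a 1 * dpi P 1 (e 1) + (\<Sum>i=1..N. ?T (dpi P 1 (e 1) + lam P) 0 i * x i 1)"
    by (simp add: stage_bound_def)
  moreover have "stage_bound x a \<rho> \<xi>' (N + 2) (e (N + 2)) = 0"
    by (simp add: stage_bound_def)
  ultimately show ?thesis
    using dep ret serv link
    unfolding penalized_def coef_const_def sum_split_ends
      sum_arcs_arc_coef[where h = "\<lambda>c e. max3 c \<rho> (tlo P e) (fst \<xi>' e) (thi P e)"]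
    by linarith
qed

section \<open>Feasible points against penalized dual values\<close>

lemma tau_binary:
  assumes "x \<in> assignments P" "mccormick_constraints P x y"
    and "i \<in> {1..N}" "i' \<in> {1..N} - {i}" "j \<in> {2..N + 1}"
  shows "lin_tau y i i' j = x i (j - 1) * xext P x i' j"
proof -
  have "x i (j - 1) \<in> {0, 1}" using assms by (intro assignments_binary[OF assms(1)]) auto
  moreover have "xext P x i' j \<in> {0, 1}"
    using assignments_binary[OF assms(1), of i' j] assms(4,5) by (auto simp: xext_def)
  moreover have "xext P x i (j - 1) = x i (j - 1)" using assms(5) by (auto simp: xext_def)
  moreover have "xext P x i (j - 1) + xext P x i' j - 1 \<le> lin_tau y i i' j \<and> 0 \<le> lin_tau y i i' j \<and>
      lin_tau y i i' j \<le> xext P x i (j - 1) \<and> lin_tau y i i' j \<le> xext P x i' j"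
    using assms(2-5) unfolding mccormick_constraints_def by blast
  ultimately show ?thesis by auto
qed

lemma mccormick_constraintsD:
  assumes "mccormick_constraints P x y" "r \<in> {1..nsamp P}" "i \<in> {1..N}"
  shows "mccormick (lam P * trav (samp P r) i 0) (lam P * thi P (i, 0))
      (u_ret y r i) (x i N) (lin_psi y r i)"
    and "\<lbrakk>i' \<in> {1..N} - {i}; j \<in> {2..N + 1}; v \<in> {j..N + 2}\<rbrakk> \<Longrightarrow>
      mccormick ((dpi P j v + lam P) * trav (samp P r) i i')
        (max ((dpi P j v + lam P) * tlo P (i, i')) ((dpi P j v + lam P) * thi P (i, i')))
        (u_link y r i i' j v) (lin_tau y i i' j) (lin_phi y r i i' j v)"
    and "v \<in> {1..N + 2} \<Longrightarrow> mccormick ((dpi P 1 v + lam P) * trav (samp P r) 0 i)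
        (max ((dpi P 1 v + lam P) * tlo P (0, i)) ((dpi P 1 v + lam P) * thi P (0, i)))
        (u_dep y r i v) (x i 1) (lin_sigma y r i v)"
    and "\<lbrakk>j \<in> {2..N + 1}; v \<in> {j..N + 2}\<rbrakk> \<Longrightarrow> mccormick (dpi P j v * serv (samp P r) i)
        (max (dpi P j v * dlo P i) (dpi P j v * dhi P i))
        (nu_serv y r i j v) (x i (j - 1)) (lin_zeta y r i j v)"
  using assms unfolding mccormick_constraints_def by blast+

text \<open>For binary \<open>x\<close> the linearized products are exact, and the bounds in
  \<open>transport_constraints\<close> place their factors above \<open>max3\<close>.\<close>

lemma stage_bound_le_milp_stage:
  assumes feas: "milp_feasible P x a y" and r: "r \<in> {1..nsamp P}"
    and j: "1 \<le> j" "j \<le> v" "v \<le> N + 2"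
  shows "stage_bound x a (rho y) (samp P r) j v \<le> milp_stage a y r j v"
proof -
  have x: "x \<in> assignments P" and mc: "mccormick_constraints P x y"
    and tr: "transport_constraints P y r"
    using feas r by (auto simp: milp_feasible_def)
  note tr' = tr[unfolded transport_constraints_def above_three_iff]
  consider "j = 1" | "j \<in> {2..N + 1}" | "j = N + 2" using j by force
  then show ?thesis
  proof cases
    case 1
    have "max3 (dpi P 1 v + lam P) (rho y) (tlo P (0, i)) (trav (samp P r) 0 i) (thi P (0, i)) * x i 1
        \<le> lin_sigma y r i v" if i: "i \<in> {1..N}" for i
    proof -
      have v: "v \<in> {1..N + 2}" using j by simp
      have b: "x i 1 \<in> {0, 1}" using i ncust_pos by (intro assignments_binary[OF x]) auto
      have "lin_sigma y r i v = u_dep y r i v * x i 1"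
        using mccormick_constraintsD(3)[OF mc r i v] mccormick_binary[OF b] by simp
      moreover have "max3 (dpi P 1 v + lam P) (rho y) (tlo P (0, i)) (trav (samp P r) 0 i) (thi P (0, i))
          \<le> u_dep y r i v"
        using tr' i v by blast
      ultimately show ?thesis using b by auto
    qed
    then show ?thesis using 1 by (auto simp: stage_bound_def milp_stage_def intro: sum_mono)
  next
    case 2
    have v: "v \<in> {j..N + 2}" using j by simp
    have serv: "max3 (dpi P j v) (rho y) (dlo P i) (serv (samp P r) i) (dhi P i) * x i (j - 1)
        \<le> lin_zeta y r i j v" if i: "i \<in> {1..N}" for i
    proof -
      have b: "x i (j - 1) \<in> {0, 1}" using i 2 by (intro assignments_binary[OF x]) auto
      have "lin_zeta y r i j v = nu_serv y r i j v * x i (j - 1)"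
        using mccormick_constraintsD(4)[OF mc r i 2 v] mccormick_binary[OF b] by simp
      moreover have "max3 (dpi P j v) (rho y) (dlo P i) (serv (samp P r) i) (dhi P i)
          \<le> nu_serv y r i j v"
        using tr' i v 2 by blast
      ultimately show ?thesis using b by auto
    qed
    have link: "max3 (dpi P j v + lam P) (rho y) (tlo P (i, i')) (trav (samp P r) i i') (thi P (i, i'))
        * (x i (j - 1) * xext P x i' j) \<le> lin_phi y r i i' j v"
      if i: "i \<in> {1..N}" "i' \<in> {1..N} - {i}" for i i'
    proof -
      have b: "x i (j - 1) * xext P x i' j \<in> {0, 1}" using i 2 by (intro assignments_succession[OF x]) auto
      have t: "lin_tau y i i' j = x i (j - 1) * xext P x i' j"
        using tau_binary[OF x mc] i 2 by blast
      have "lin_phi y r i i' j v = u_link y r i i' j v * lin_tau y i i' j"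
        using mccormick_constraintsD(2)[OF mc r i 2 v] mccormick_binary[OF b] by (simp add: t)
      moreover have "max3 (dpi P j v + lam P) (rho y) (tlo P (i, i')) (trav (samp P r) i i') (thi P (i, i'))
          \<le> u_link y r i i' j v"
        using tr' i v 2 by blast
      ultimately show ?thesis using b unfolding t by auto
    qed
    have "j \<noteq> 1" "j \<le> N + 1" using 2 by auto
    then show ?thesis
      unfolding stage_bound_def milp_stage_def
      by (simp only: if_True if_False) (intro add_mono sum_mono order_refl serv link)
  next
    case 3
    then show ?thesis by (simp add: stage_bound_def milp_stage_def)
  qed
qed

text \<open>The program has only two bounds for return arcs: as \<open>lam P\<close> is nonnegative,
  the candidate at the lower end never beats the one at the sample.\<close>

lemma max3_return:
  assumes "r \<in> {1..nsamp P}" "i \<in> {1..N}" "0 \<le> \<rho>"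
  shows "max3 (lam P) \<rho> (tlo P (i, 0)) (trav (samp P r) i 0) (thi P (i, 0)) \<le> z \<longleftrightarrow>
    lam P * trav (samp P r) i 0 \<le> z \<and>
    lam P * thi P (i, 0) - \<rho> * (thi P (i, 0) - trav (samp P r) i 0) \<le> z"
proof -
  have "tlo P (i, 0) \<le> trav (samp P r) i 0"
    using support_bounds(2)[of "samp P r" "(i, 0)"] samples assms by auto
  then have "lam P * tlo P (i, 0) \<le> lam P * trav (samp P r) i 0"
      "0 \<le> \<rho> * (trav (samp P r) i 0 - tlo P (i, 0))"
    using lam_nonneg assms by (auto intro: mult_left_mono)
  then show ?thesis by (auto simp: max3_def)
qed

lemma penalized_le_milp:
  assumes feas: "milp_feasible P x a y" and r: "r \<in> {1..nsamp P}" and e: "block_ends (N + 2) e"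
  shows "penalized x a (rho y) e (samp P r) \<le> (\<Sum>i=1..N. lin_psi y r i) + (\<Sum>j=1..N + 2. beta y r j)"
proof -
  have x: "x \<in> assignments P" and mc: "mccormick_constraints P x y" and \<rho>: "0 \<le> rho y"
    and tr: "transport_constraints P y r" and be: "beta_constraints P a y r"
    using feas r by (auto simp: milp_feasible_def)
  have "(\<Sum>j=1..N + 2. stage_bound x a (rho y) (samp P r) j (e j)) \<le> (\<Sum>j=1..N + 2. milp_stage a y r j (e j))"
    using block_ends_bounds[OF e] by (intro sum_mono stage_bound_le_milp_stage[OF feas r]) auto
  also have "\<dots> \<le> (\<Sum>j=1..N + 2. beta y r j)"
    using be by (intro block_sum_le[OF e]) (auto simp: beta_constraints_iff)
  finally have "(\<Sum>j=1..N + 2. stage_bound x a (rho y) (samp P r) j (e j)) \<le> (\<Sum>j=1..N + 2. beta y r j)" .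
  moreover have "max3 (lam P) (rho y) (tlo P (i, 0)) (trav (samp P r) i 0) (thi P (i, 0)) * x i N
      \<le> lin_psi y r i" if i: "i \<in> {1..N}" for i
  proof -
    have b: "x i N \<in> {0, 1}" using i ncust_pos by (intro assignments_binary[OF x]) auto
    have "lin_psi y r i = u_ret y r i * x i N"
      using mccormick_constraintsD(1)[OF mc r i] mccormick_binary[OF b] by simp
    moreover have "max3 (lam P) (rho y) (tlo P (i, 0)) (trav (samp P r) i 0) (thi P (i, 0)) \<le> u_ret y r i"
      using tr i unfolding max3_return[OF r i \<rho>] transport_constraints_def by blast
    ultimately show ?thesis using b by auto
  qed
  then have "(\<Sum>i=1..N. max3 (lam P) (rho y) (tlo P (i, 0)) (trav (samp P r) i 0) (thi P (i, 0)) * x i N)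
      \<le> (\<Sum>i=1..N. lin_psi y r i)"
    by (rule sum_mono)
  ultimately show ?thesis
    using penalized_eq_stages[OF x _ \<rho>, of "samp P r" a e] samples r by auto
qed

text \<open>With all linearized quantities at their least values, longest-path potentials for
  \<open>beta\<close> make the contribution of each sample equal to the penalized value of an
  optimal partition \<open>e r\<close>.\<close>

lemma milp_completion:
  assumes x: "x \<in> assignments P" and a: "a \<in> appointments P" and \<rho>: "0 \<le> \<rho>"
  obtains y e where "milp_feasible P x a y" "rho y = \<rho>"
    "\<And>r. r \<in> {1..nsamp P} \<Longrightarrow> block_ends (N + 2) (e r)"
    "\<And>r. r \<in> {1..nsamp P} \<Longrightarrow>
      (\<Sum>i=1..N. lin_psi y r i) + (\<Sum>j=1..N + 2. beta y r j) = penalized x a \<rho> (e r) (samp P r)"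
proof -
  let ?T = "\<lambda>c r i i'. max3 c \<rho> (tlo P (i, i')) (trav (samp P r) i i') (thi P (i, i'))"
  let ?S = "\<lambda>c r i. max3 c \<rho> (dlo P i) (serv (samp P r) i) (dhi P i)"
  define optimal where "optimal r b e \<longleftrightarrow> block_ends (N + 2) e \<and>
    (\<forall>k v. 1 \<le> k \<and> k \<le> v \<and> v \<le> N + 2 \<longrightarrow>
      (\<Sum>j=k..v. stage_bound x a \<rho> (samp P r) j v) \<le> (\<Sum>j=k..v. b j)) \<and>
    (\<Sum>j=1..N + 2. b j) = (\<Sum>j=1..N + 2. stage_bound x a \<rho> (samp P r) j (e j))" for r b e
  have "\<forall>r. \<exists>be. optimal r (fst be) (snd be)"
  proof
    fix r
    obtain b e where "optimal r b e"
      unfolding optimal_def by (rule block_potential[of "N + 2" "stage_bound x a \<rho> (samp P r)"]) blast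
    then show "\<exists>be. optimal r (fst be) (snd be)" by (intro exI[of _ "(b, e)"]) simp
  qed
  then obtain be where "\<forall>r. optimal r (fst (be r)) (snd (be r))"
    by (rule choice[THEN exE])
  moreover define b e where "b r = fst (be r)" and "e r = snd (be r)" for r
  ultimately have "optimal r (b r) (e r)" for r by simp
  then have e: "block_ends (N + 2) (e r)"
    and b: "1 \<le> k \<and> k \<le> v \<and> v \<le> N + 2 \<longrightarrow>
      (\<Sum>j=k..v. stage_bound x a \<rho> (samp P r) j v) \<le> (\<Sum>j=k..v. b r j)"
    and bs: "(\<Sum>j=1..N + 2. b r j) = (\<Sum>j=1..N + 2. stage_bound x a \<rho> (samp P r) j (e r j))" for r k v
    unfolding optimal_def by blast+
  \<comment> \<open>Every factor is its \<open>max3\<close>, every linearization variable the true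
    product.\<close>
  define y where "y = \<lparr> rho = \<rho>, beta = b,
    u_ret = \<lambda>r i. ?T (lam P) r i 0,
    u_dep = \<lambda>r i v. ?T (dpi P 1 v + lam P) r 0 i,
    u_link = \<lambda>r i i' j v. ?T (dpi P j v + lam P) r i i',
    nu_serv = \<lambda>r i j v. ?S (dpi P j v) r i,
    lin_tau = \<lambda>i i' j. x i (j - 1) * xext P x i' j,
    lin_psi = \<lambda>r i. ?T (lam P) r i 0 * x i N,
    lin_phi = \<lambda>r i i' j v. ?T (dpi P j v + lam P) r i i' * (x i (j - 1) * xext P x i' j),
    lin_sigma = \<lambda>r i v. ?T (dpi P 1 v + lam P) r 0 i * x i 1,
    lin_zeta = \<lambda>r i j v. ?S (dpi P j v) r i * x i (j - 1) \<rparr>"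
  have t: "tlo P c \<le> fst (samp P r) c" "fst (samp P r) c \<le> thi P c"
    if "r \<in> {1..nsamp P}" "c \<in> arcs P" for r c
    using support_bounds samples that by auto
  have d: "dlo P i \<le> serv (samp P r) i" "serv (samp P r) i \<le> dhi P i"
    if "r \<in> {1..nsamp P}" "i \<in> {1..N}" for r i
    using support_bounds samples that by auto
  have "milp_stage a y r j v = stage_bound x a \<rho> (samp P r) j v" for r j v
    by (simp add: milp_stage_def stage_bound_def y_def)
  moreover have "beta y = b" by (simp add: y_def)
  ultimately have "beta_constraints P a y r" for r
    unfolding beta_constraints_iff using b by simp
  moreover have "transport_constraints P y r" if r: "r \<in> {1..nsamp P}" for r
    unfolding transport_constraints_def above_three_iff
    by (simp add: y_def) (auto simp: max3_def)
  moreover have "mccormick_constraints P x y"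
    unfolding mccormick_constraints_def
  proof (intro conjI ballI)
    fix i i' j
    assume i: "i \<in> {1..N}" "i' \<in> {1..N} - {i}" and j: "j \<in> {2..N + 1}"
    have "x i (j - 1) \<in> {0, 1}" using i j by (intro assignments_binary[OF x]) auto
    moreover have "xext P x i' j \<in> {0, 1}"
      using assignments_binary[OF x, of i' j] i j by (auto simp: xext_def)
    moreover have "xext P x i (j - 1) = x i (j - 1)" using j by (auto simp: xext_def)
    ultimately show "xext P x i (j - 1) + xext P x i' j - 1 \<le> lin_tau y i i' j"
      "0 \<le> lin_tau y i i' j" "lin_tau y i i' j \<le> xext P x i (j - 1)"
      "lin_tau y i i' j \<le> xext P x i' j"
      by (auto simp: y_def)
  next
    fix r i assume r: "r \<in> {1..nsamp P}" and i: "i \<in> {1..N}"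
    have b: "x i N \<in> {0, 1}" using i ncust_pos by (intro assignments_binary[OF x]) auto
    \<comment> \<open>For a nonnegative coefficient the larger end-point product is the one at the
      upper end, the form in which the program states this bound.\<close>
    have "lam P * tlo P (i, 0) \<le> lam P * thi P (i, 0)"
      using t[OF r, of "(i, 0)"] i lam_nonneg by (intro mult_left_mono) auto
    then show "mccormick (lam P * trav (samp P r) i 0) (lam P * thi P (i, 0))
        (u_ret y r i) (x i N) (lin_psi y r i)"
      using mccormick_max3[OF b \<rho> t[OF r, of "(i, 0)"], of "lam P"] i by (simp add: y_def max_def)
  next
    fix r i i' j v
    assume r: "r \<in> {1..nsamp P}" and i: "i \<in> {1..N}" "i' \<in> {1..N} - {i}" and j: "j \<in> {2..N + 1}"
    show "mccormick ((dpi P j v + lam P) * trav (samp P r) i i')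
        (max ((dpi P j v + lam P) * tlo P (i, i')) ((dpi P j v + lam P) * thi P (i, i')))
        (u_link y r i i' j v) (lin_tau y i i' j) (lin_phi y r i i' j v)"
      unfolding y_def milp_vars.simps using r i j
      by (intro mccormick_max3 assignments_succession[OF x] \<rho> t) auto
  next
    fix r i v assume r: "r \<in> {1..nsamp P}" and i: "i \<in> {1..N}"
    show "mccormick ((dpi P 1 v + lam P) * trav (samp P r) 0 i)
        (max ((dpi P 1 v + lam P) * tlo P (0, i)) ((dpi P 1 v + lam P) * thi P (0, i)))
        (u_dep y r i v) (x i 1) (lin_sigma y r i v)"
      unfolding y_def milp_vars.simps using r i ncust_pos
      by (intro mccormick_max3 assignments_binary[OF x] \<rho> t) auto
  next
    fix r i j v assume r: "r \<in> {1..nsamp P}" and i: "i \<in> {1..N}" and j: "j \<in> {2..N + 1}"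
    show "mccormick (dpi P j v * serv (samp P r) i)
        (max (dpi P j v * dlo P i) (dpi P j v * dhi P i))
        (nu_serv y r i j v) (x i (j - 1)) (lin_zeta y r i j v)"
      unfolding y_def milp_vars.simps using r i j
      by (intro mccormick_max3 assignments_binary[OF x] \<rho> d) auto
  qed
  ultimately have "milp_feasible P x a y"
    using x a \<rho> by (auto simp: milp_feasible_def y_def)
  moreover have "(\<Sum>i=1..N. lin_psi y r i) + (\<Sum>j=1..N + 2. beta y r j)
      = penalized x a \<rho> (e r) (samp P r)" if "r \<in> {1..nsamp P}" for r
  proof -
    have s: "samp P r \<in> support P" using samples that by blast
    show ?thesis
      unfolding penalized_eq_stages[OF x s \<rho>] bs[symmetric] by (simp add: y_def)
  qed
  moreover have "rho y = \<rho>" by (simp add: y_def)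
  ultimately show ?thesis using that e by blast
qed

subsection \<open>Wasserstein duality\<close>

lemma space_support_space: "space (support_space P) = support P"
  by (auto simp: support_space_def space_restrict_space support_def)

lemma measurable_scenario:
  "c \<in> arcs P \<Longrightarrow> (\<lambda>\<xi>. fst \<xi> c) \<in> borel_measurable (support_space P)"
  "i \<in> {1..N} \<Longrightarrow> (\<lambda>\<xi>. snd \<xi> i) \<in> borel_measurable (support_space P)"
  unfolding support_space_def scenario_space_def
  by (auto intro!: measurable_restrict_space1
      measurable_compose[OF measurable_fst measurable_component_singleton]
      measurable_compose[OF measurable_snd measurable_component_singleton])

text \<open>The greedy closed form consists of finitely many sums, products and maxima of
  coordinates.\<close>

lemma measurable_second_stage:
  "(\<lambda>\<xi>. second_stage P x a \<xi>) \<in> borel_measurable (support_space P)"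
proof -
  have t: "(\<lambda>\<xi>. trav \<xi> i i') \<in> borel_measurable (support_space P)"
    if "i \<le> N" "i' \<le> N" "i \<noteq> i'" for i i'
    using that by (intro measurable_scenario) simp
  have rhs: "(\<lambda>\<xi>. rhs x a \<xi> j) \<in> borel_measurable (support_space P)" for j
  proof (cases "j = 1")
    case True
    then show ?thesis unfolding rhs_def
      by (simp only: True simp_thms if_True) (intro borel_measurable_diff borel_measurable_sum
          borel_measurable_times borel_measurable_const t, auto)
  next
    case False
    then show ?thesis unfolding rhs_def
      by (simp only: False simp_thms if_False) (intro borel_measurable_add borel_measurable_diff
          borel_measurable_sum borel_measurable_times borel_measurable_const t measurable_scenario, auto)
  qed
  have wait: "(\<lambda>\<xi>. wait (rhs x a \<xi>) j) \<in> borel_measurable (support_space P)" for j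
    by (induction j) (auto intro!: borel_measurable_max borel_measurable_add rhs)
  have idle: "(\<lambda>\<xi>. idle (rhs x a \<xi>) j) \<in> borel_measurable (support_space P)" for j
    unfolding idle_def
    by (intro borel_measurable_max borel_measurable_uminus borel_measurable_add
        borel_measurable_const wait rhs)
  have "(\<lambda>\<xi>. total_travel P x \<xi>) \<in> borel_measurable (support_space P)"
    unfolding total_travel_def travel_between_def
    by (intro borel_measurable_add borel_measurable_sum borel_measurable_times
        borel_measurable_const t) auto
  then show ?thesis
    unfolding second_stage_greedy lp_objective_eq
    by (intro borel_measurable_add borel_measurable_sum borel_measurable_times
        borel_measurable_const wait idle)
qed

lemma measurable_dist1:
  "(\<lambda>z. dist1 P (fst z) (snd z)) \<in> borel_measurable (support_space P \<Otimes>\<^sub>M support_space P)"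
  unfolding dist1_def
  by (intro borel_measurable_add borel_measurable_sum borel_measurable_abs borel_measurable_diff
      measurable_compose[OF measurable_fst measurable_scenario(1)]
      measurable_compose[OF measurable_snd measurable_scenario(1)]
      measurable_compose[OF measurable_fst measurable_scenario(2)]
      measurable_compose[OF measurable_snd measurable_scenario(2)])

lemma dist1_nonneg: "0 \<le> dist1 P \<xi> \<xi>'"
  by (simp add: dist1_def sum_nonneg)

text \<open>Restricting to \<open>{..N + 2}\<close> makes the set of partitions finite.\<close>

definition partitions where
  "partitions = {e \<in> {..N + 2} \<rightarrow>\<^sub>E {..N + 2}. block_ends (N + 2) e}"

lemma finite_partitions: "finite partitions"
  unfolding partitions_def by (rule finite_subset[OF _ finite_PiE[of "{..N + 2}" "\<lambda>_. {..N + 2}"]]) auto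

text \<open>The dual value reads \<open>e\<close> only on \<open>{1..N + 1}\<close>, so an optimal
  partition may be restricted to the finite index range.\<close>

lemma second_stage_partition:
  obtains e where "e \<in> partitions" "second_stage P x a \<xi> = dual_value x a e \<xi>"
proof -
  obtain e where e: "block_ends (N + 2) e" and v: "second_stage P x a \<xi> = dual_value x a e \<xi>"
    by (rule second_stage_attained)
  let ?e = "restrict e {..N + 2}"
  have "block_ends (N + 2) ?e" using e by (auto simp: block_ends_def)
  then have "?e \<in> partitions" using block_ends_bounds[OF e] by (auto simp: partitions_def)
  moreover have "dual_value x a ?e \<xi> = dual_value x a e \<xi>"
    unfolding dual_value_def by (intro arg_cong2[of _ _ _ _ "(+)"] sum.cong refl) auto
  ultimately show ?thesis using that v by simp
qed

text \<open>At a point of the support this is the c-transform of the second-stage value for the cost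
  \<open>\<rho>\<close> times the distance; the maximum over finitely many partitions keeps it
  measurable.\<close>

definition worst_penalized where
  "worst_penalized x a \<rho> \<xi>' = Max ((\<lambda>e. penalized x a \<rho> e \<xi>') ` partitions)"

lemma measurable_worst_penalized:
  "(\<lambda>\<xi>'. worst_penalized x a \<rho> \<xi>') \<in> borel_measurable (support_space P)"
  unfolding worst_penalized_def penalized_def max3_def
  by (intro borel_measurable_Max finite_partitions borel_measurable_add borel_measurable_sum
      borel_measurable_max borel_measurable_diff borel_measurable_times borel_measurable_const
      measurable_scenario)

lemma second_stage_le_worst_penalized:
  assumes "\<xi> \<in> support P"
  shows "second_stage P x a \<xi> \<le> worst_penalized x a \<rho> \<xi>' + \<rho> * dist1 P \<xi> \<xi>'"
proof -
  obtain e where e: "e \<in> partitions" and v: "second_stage P x a \<xi> = dual_value x a e \<xi>"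
    by (rule second_stage_partition)
  have "penalized x a \<rho> e \<xi>' \<le> worst_penalized x a \<rho> \<xi>'"
    unfolding worst_penalized_def using e finite_partitions by (intro Max_ge) auto
  then show ?thesis using penalized_upper[OF assms, of x a e \<rho> \<xi>'] v by simp
qed

lemma worst_penalized_le_milp:
  assumes "milp_feasible P x a y" "r \<in> {1..nsamp P}"
  shows "worst_penalized x a (rho y) (samp P r) \<le> (\<Sum>i=1..N. lin_psi y r i) + (\<Sum>j=1..N + 2. beta y r j)"
proof -
  \<comment> \<open>The maximum needs a nonempty set of partitions.\<close>
  obtain e where "e \<in> partitions" by (rule second_stage_partition)
  then show ?thesis
    unfolding worst_penalized_def using finite_partitions penalized_le_milp[OF assms]
    by (intro Max.boundedI) (auto simp: partitions_def)
qed

text \<open>Unlike \<open>samp P\<close>, which is arbitrary off \<open>[R]\<close>, this is a measurable map into the support.\<close>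

definition sample where
  "sample r = samp P (if r \<in> {1..nsamp P} then r else 1)"

abbreviation sample_pmf :: "nat pmf" where
  "sample_pmf \<equiv> pmf_of_set {1..nsamp P}"

lemma sample_support: "sample r \<in> support P"
  using samples nsamp_pos by (auto simp: sample_def)

lemma measurable_selection:
  "(\<And>z. k z \<in> support P) \<Longrightarrow> k \<in> measurable (measure_pmf p) (support_space P)"
  by (simp add: space_support_space)

text \<open>The average of Dirac measures is the image of the uniform distribution on the sample
  indices, so integrals against it become finite averages.\<close>

lemma empirical_eq: "empirical P = distr sample_pmf (support_space P) sample"
proof -
  let ?S = "support_space P" and ?D = "distr sample_pmf (support_space P) sample"
  have "ennreal (1 / real (nsamp P)) * (\<Sum>r=1..nsamp P. emeasure (return ?S (samp P r)) A)
      = emeasure ?D A" if "A \<in> sets ?S" for A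
  proof -
    have "emeasure ?D A = (\<integral>\<^sup>+ \<xi>. indicator A \<xi> \<partial>?D)"
      using that by simp
    also have "\<dots> = (\<integral>\<^sup>+ r. indicator A (sample r) \<partial>sample_pmf)"
      using that by (intro nn_integral_distr measurable_selection sample_support) auto
    also have "\<dots> = (\<Sum>r=1..nsamp P. indicator A (sample r)) / of_nat (nsamp P)"
      using nsamp_pos by (subst nn_integral_pmf_of_set) (auto simp: ennreal_of_nat_eq_real_of_nat)
    also have "\<dots> = ennreal (1 / real (nsamp P)) * (\<Sum>r=1..nsamp P. indicator A (sample r))"
      using nsamp_pos by (simp add: divide_ennreal_def ennreal_of_nat_eq_real_of_nat inverse_ennreal
          inverse_eq_divide mult.commute)
    also have "(\<Sum>r=1..nsamp P. indicator A (sample r))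
        = (\<Sum>r=1..nsamp P. emeasure (return ?S (samp P r)) A)"
      using that by (intro sum.cong refl) (simp add: sample_def)
    finally show ?thesis by simp
  qed
  then have "empirical P = measure_of (space ?S) (sets ?S) (emeasure ?D)"
    unfolding empirical_def
    by (intro measure_of_eq) (auto simp: sets.space_closed sets.sigma_sets_eq)
  then show ?thesis using measure_of_of_measure[of ?D] by simp
qed

lemma integral_sample_pmf:
  "(\<integral>r. h r \<partial>sample_pmf) = 1 / real (nsamp P) * (\<Sum>r=1..nsamp P. h r)" for h :: "nat \<Rightarrow> real"
  using nsamp_pos by (subst integral_pmf_of_set) auto

lemma weak_duality:
  assumes feas: "milp_feasible P x a y" and Q: "Q \<in> ambiguity P"
  shows "(\<integral>\<xi>. second_stage P x a \<xi> \<partial>Q) \<le> milp_objective P y"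
proof -
  let ?f = "second_stage P x a" and ?F = "worst_penalized x a (rho y)"
    and ?S = "support_space P" and ?d = "\<lambda>z. dist1 P (fst z) (snd z)"
  have x: "x \<in> assignments P" and \<rho>: "0 \<le> rho y" using feas by (auto simp: milp_feasible_def)
  have sQ: "sets Q = sets ?S" and W: "wasserstein1 P Q (empirical P) \<le> ennreal (eps P)"
    using Q by (auto simp: ambiguity_def)
  have sE: "sets (empirical P) = sets ?S" by (simp add: empirical_eq)
  have bound: "(\<integral>\<xi>. ?f \<xi> \<partial>Q) \<le> (\<integral>\<xi>. ?F \<xi> \<partial>empirical P) + rho y * (eps P + \<eta>)" if \<eta>: "0 < \<eta>" for \<eta>
  proof -
    \<comment> \<open>The infimum over couplings need not be attained; the slack
      \<open>\<eta>\<close> provides a coupling that is cheap enough.\<close>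
    have "wasserstein1 P Q (empirical P) < ennreal (eps P + \<eta>)"
      using W eps_pos \<eta> by (intro le_less_trans[OF W]) (auto intro: ennreal_lessI)
    then obtain M where M: "M \<in> couplings Q (empirical P)"
      and cost: "(\<integral>\<^sup>+ z. ennreal (?d z) \<partial>M) < ennreal (eps P + \<eta>)"
      unfolding wasserstein1_def by (auto simp: INF_less_iff)
    have sM: "sets M = sets (?S \<Otimes>\<^sub>M ?S)"
      using M sets_pair_measure_cong[OF sQ sE] by (simp add: couplings_def)
    have QM: "distr M Q fst = Q" and EM: "distr M (empirical P) snd = empirical P"
      using M by (auto simp: couplings_def)
    have spM: "space M = support P \<times> support P"
      using sets_eq_imp_space_eq[OF sM] by (simp add: space_pair_measure space_support_space)
    have fstM: "fst \<in> measurable M Q"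
      using measurable_cong_sets[OF sM sQ] measurable_fst by blast
    have sndM: "snd \<in> measurable M (empirical P)"
      using measurable_cong_sets[OF sM sE] measurable_snd by blast
    have fQ: "?f \<in> borel_measurable Q"
      using measurable_second_stage measurable_cong_sets[OF sQ refl] by blast
    have FE: "?F \<in> borel_measurable (empirical P)"
      using measurable_worst_penalized measurable_cong_sets[OF sE refl] by blast
    have dM: "?d \<in> borel_measurable M"
      using measurable_dist1 measurable_cong_sets[OF sM refl] by blast
    have d: "integrable M ?d"
      using cost dM dist1_nonneg
      by (intro integrableI_nonneg) (auto intro: less_trans ennreal_less_top)
    have "integrable (empirical P) ?F"
      unfolding empirical_eq using nsamp_pos
      by (subst integrable_distr_eq[OF measurable_selection[OF sample_support] measurable_worst_penalized])
        (auto intro!: integrable_measure_pmf_finite)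
    then have F: "integrable M (\<lambda>z. ?F (snd z))"
      by (subst (asm) EM[symmetric]) (rule integrable_distr[OF sndM])
    have le: "?f (fst z) \<le> ?F (snd z) + rho y * ?d z" if "z \<in> space M" for z
      using that second_stage_le_worst_penalized by (auto simp: spM)
    have nn: "0 \<le> ?f (fst z)" if "z \<in> space M" for z
      using that second_stage_nonneg[OF x] by (auto simp: spM)
    have "(\<integral>\<xi>. ?f \<xi> \<partial>Q) = (\<integral>z. ?f (fst z) \<partial>M)"
      by (subst QM[symmetric], rule integral_distr[OF fstM fQ])
    \<comment> \<open>The majorant is integrable and nonnegative, which also covers the value 0 that
      the integral takes by default on a function that is not integrable.\<close>
    also have "\<dots> \<le> (\<integral>z. ?F (snd z) + rho y * ?d z \<partial>M)"
      using F d le order_trans[OF nn le]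
      by (intro integral_mono' Bochner_Integration.integrable_add integrable_mult_right) auto
    also have "\<dots> = (\<integral>z. ?F (snd z) \<partial>M) + rho y * (\<integral>z. ?d z \<partial>M)"
      using F d by simp
    also have "(\<integral>z. ?F (snd z) \<partial>M) = (\<integral>\<xi>. ?F \<xi> \<partial>empirical P)"
      using integral_distr[OF sndM FE] unfolding EM by (rule sym)
    also have "(\<integral>z. ?d z \<partial>M) \<le> eps P + \<eta>"
    proof -
      have "ennreal (\<integral>z. ?d z \<partial>M) \<le> ennreal (eps P + \<eta>)"
        using cost nn_integral_eq_integral[OF d] dist1_nonneg by simp
      moreover have "0 \<le> eps P + \<eta>" using eps_pos \<eta> by simp
      ultimately show ?thesis by (rule ennreal_le_iff[THEN iffD1, rotated])
    qed
    finally show ?thesis using \<rho> by (simp add: mult_left_mono)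
  qed
  have emp: "(\<integral>\<xi>. ?F \<xi> \<partial>empirical P) = 1 / real (nsamp P) * (\<Sum>r=1..nsamp P. ?F (samp P r))"
    unfolding empirical_eq integral_sample_pmf
      integral_distr[OF measurable_selection[OF sample_support] measurable_worst_penalized]
    by (simp add: sample_def)
  have "(\<integral>\<xi>. ?f \<xi> \<partial>Q) \<le> (\<integral>\<xi>. ?F \<xi> \<partial>empirical P) + rho y * eps P"
  proof (rule field_le_epsilon)
    fix \<eta> :: real
    assume \<eta>: "0 < \<eta>"
    \<comment> \<open>Dividing by \<open>rho y + 1\<close> instead of \<open>rho y\<close> also
      covers a zero multiplier.\<close>
    have "rho y * (\<eta> / (rho y + 1)) \<le> \<eta>"
      using \<rho> \<eta> by (simp add: field_simps)
    moreover have "0 < \<eta> / (rho y + 1)" using \<rho> \<eta> by simp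
    ultimately show "(\<integral>\<xi>. ?f \<xi> \<partial>Q) \<le> (\<integral>\<xi>. ?F \<xi> \<partial>empirical P) + rho y * eps P + \<eta>"
      using bound[of "\<eta> / (rho y + 1)"] by (simp add: distrib_left)
  qed
  also have "(\<Sum>r=1..nsamp P. ?F (samp P r))
      \<le> (\<Sum>r=1..nsamp P. (\<Sum>i=1..N. lin_psi y r i) + (\<Sum>j=1..N + 2. beta y r j))"
    by (intro sum_mono worst_penalized_le_milp[OF feas])
  then have "(\<integral>\<xi>. ?F \<xi> \<partial>empirical P) + rho y * eps P \<le> milp_objective P y"
    unfolding emp milp_objective_def
    using mult_left_mono[of _ _ "1 / real (nsamp P)"] by (simp add: mult.commute)
  finally show ?thesis .
qed

section \<open>Two-point mixtures and strong duality\<close>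

definition average :: "(nat \<Rightarrow> real) \<Rightarrow> real" where
  "average h = 1 / real (nsamp P) * (\<Sum>r=1..nsamp P. h r)"

lemma integral_mixture:
  fixes h :: "nat \<times> bool \<Rightarrow> real"
  assumes "0 \<le> \<theta>" "\<theta> \<le> 1"
  shows "(\<integral>z. h z \<partial>pair_pmf sample_pmf (bernoulli_pmf \<theta>))
    = (1 - \<theta>) * average (\<lambda>r. h (r, False)) + \<theta> * average (\<lambda>r. h (r, True))"
proof -
  let ?R = "{1..nsamp P}"
  have fin: "finite ?R" "?R \<noteq> {}" using nsamp_pos by auto
  have "(\<integral>z. h z \<partial>pair_pmf sample_pmf (bernoulli_pmf \<theta>))
      = (\<Sum>z\<in>?R \<times> UNIV. h z * pmf (pair_pmf sample_pmf (bernoulli_pmf \<theta>)) z)"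
    using fin by (intro integral_measure_pmf_real) auto
  also have "\<dots> = (\<Sum>r\<in>?R. \<Sum>b\<in>UNIV. h (r, b) * pmf (pair_pmf sample_pmf (bernoulli_pmf \<theta>)) (r, b))"
    by (simp add: sum.cartesian_product case_prod_unfold)
  also have "\<dots> = (\<Sum>r\<in>?R. (1 - \<theta>) * (1 / real (nsamp P) * h (r, False))
      + \<theta> * (1 / real (nsamp P) * h (r, True)))"
    using fin assms by (intro sum.cong refl) (simp add: UNIV_bool pmf_pair mult.commute)
  finally show ?thesis
    by (simp only: sum.distrib sum_distrib_left[symmetric] average_def)
qed

text \<open>A sample index and a coin are drawn independently, and the sample is moved to
  \<open>k r\<close> or \<open>k' r\<close> according to the coin. The joint law of the moved
  scenario and the sample is a coupling whose cost is the left side of the budget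
  inequality.\<close>

lemma mixture_ambiguity:
  assumes k: "\<And>r. k r \<in> support P" "\<And>r. k' r \<in> support P" and \<theta>: "0 \<le> \<theta>" "\<theta> \<le> 1"
    and budget: "(1 - \<theta>) * average (\<lambda>r. dist1 P (k r) (sample r))
      + \<theta> * average (\<lambda>r. dist1 P (k' r) (sample r)) \<le> eps P"
  obtains Q where "Q \<in> ambiguity P"
    "(\<integral>\<xi>. second_stage P x a \<xi> \<partial>Q) = (1 - \<theta>) * average (\<lambda>r. second_stage P x a (k r))
      + \<theta> * average (\<lambda>r. second_stage P x a (k' r))"
proof -
  let ?S = "support_space P" and ?p = "pair_pmf sample_pmf (bernoulli_pmf \<theta>)"
  define \<kappa> where "\<kappa> z = (if snd z then k' (fst z) else k (fst z))" for z :: "nat \<times> bool"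
  define s where "s z = sample (fst z)" for z :: "nat \<times> bool"
  define Q where "Q = distr ?p ?S \<kappa>"
  define M where "M = distr ?p (?S \<Otimes>\<^sub>M ?S) (\<lambda>z. (\<kappa> z, s z))"
  have \<kappa>: "\<kappa> \<in> measurable ?p ?S" by (rule measurable_selection) (simp add: \<kappa>_def k)
  have s: "s \<in> measurable ?p ?S" by (rule measurable_selection) (simp add: s_def sample_support)
  have pair: "(\<lambda>z. (\<kappa> z, s z)) \<in> measurable ?p (?S \<Otimes>\<^sub>M ?S)"
    using \<kappa> s by (rule measurable_Pair)
  have "distr ?p ?S s = empirical P"
  proof -
    have "distr ?p ?S s = distr (distr ?p (count_space UNIV) fst) ?S sample"
      by (subst distr_distr) (auto simp: space_support_space sample_support s_def[abs_def] comp_def)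
    also have "distr ?p (count_space UNIV) fst = map_pmf fst ?p"
      by (simp add: map_pmf_rep_eq)
    finally show ?thesis by (simp add: map_fst_pair_pmf empirical_eq)
  qed
  \<comment> \<open>An image measure depends on its target only through the measurable sets.\<close>
  moreover have "distr M (empirical P) snd = distr M ?S snd"
    by (rule distr_cong) (auto simp: empirical_eq)
  moreover have "distr M ?S snd = distr ?p ?S s"
    unfolding M_def distr_distr[OF measurable_snd pair] by (simp add: comp_def)
  ultimately have snd: "distr M (empirical P) snd = empirical P" by simp
  have "distr M Q fst = distr M ?S fst"
    by (rule distr_cong) (auto simp: Q_def)
  moreover have "distr M ?S fst = Q"
    unfolding M_def distr_distr[OF measurable_fst pair] by (simp add: comp_def Q_def)
  ultimately have fst: "distr M Q fst = Q" by simp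
  have "M \<in> couplings Q (empirical P)"
    unfolding couplings_def
  proof (intro CollectI conjI fst snd)
    show "prob_space M"
      unfolding M_def by (intro prob_space.prob_space_distr measure_pmf.prob_space_axioms pair)
    show "sets M = sets (Q \<Otimes>\<^sub>M empirical P)"
      by (simp add: M_def Q_def empirical_eq cong: sets_pair_measure_cong)
  qed
  then have "wasserstein1 P Q (empirical P) \<le> (\<integral>\<^sup>+ z. ennreal (dist1 P (fst z) (snd z)) \<partial>M)"
    unfolding wasserstein1_def by (rule INF_lower)
  also have "\<dots> = (\<integral>\<^sup>+ z. ennreal (dist1 P (\<kappa> z) (s z)) \<partial>?p)"
    unfolding M_def using measurable_dist1 pair by (subst nn_integral_distr) auto
  also have "\<dots> = ennreal (\<integral>z. dist1 P (\<kappa> z) (s z) \<partial>?p)"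
    using nsamp_pos
    by (intro nn_integral_eq_integral integrable_measure_pmf_finite) (auto simp: dist1_nonneg)
  also have "\<dots> \<le> ennreal (eps P)"
    using budget integral_mixture[OF \<theta>] by (intro ennreal_leI) (simp add: \<kappa>_def s_def)
  finally have "wasserstein1 P Q (empirical P) \<le> ennreal (eps P)" .
  moreover have "prob_space Q"
    unfolding Q_def by (intro prob_space.prob_space_distr measure_pmf.prob_space_axioms \<kappa>)
  ultimately have "Q \<in> ambiguity P" by (simp add: ambiguity_def Q_def)
  moreover have "(\<integral>\<xi>. second_stage P x a \<xi> \<partial>Q) = (1 - \<theta>) * average (\<lambda>r. second_stage P x a (k r))
      + \<theta> * average (\<lambda>r. second_stage P x a (k' r))"
    unfolding Q_def integral_distr[OF \<kappa> measurable_second_stage] integral_mixture[OF \<theta>]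
    by (simp add: \<kappa>_def)
  ultimately show ?thesis by (rule that)
qed

lemma worst_case_le_milp:
  "milp_feasible P x a y \<Longrightarrow> worst_case P x a \<le> ereal (milp_objective P y)"
  unfolding worst_case_def by (intro SUP_least) (simp add: weak_duality)

text \<open>The multiplier \<open>\<rho>\<close> bounds every selection of scenarios, one per
  sample. The completion of the program at this \<open>\<rho>\<close> has the value of one such
  selection, formed by maximizers of the penalized dual values.\<close>

lemma strong_duality:
  assumes x: "x \<in> assignments P" and a: "a \<in> appointments P"
  obtains y where "milp_feasible P x a y" "ereal (milp_objective P y) = worst_case P x a"
proof -
  let ?f = "second_stage P x a" and ?d = "\<lambda>k r. dist1 P (k r) (sample r)"
  have mixture_le: "ereal ((1 - \<theta>) * average (\<lambda>r. ?f (k r)) + \<theta> * average (\<lambda>r. ?f (k' r)))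
      \<le> worst_case P x a"
    if k: "k \<in> UNIV \<rightarrow> support P" "k' \<in> UNIV \<rightarrow> support P" "0 \<le> \<theta>" "\<theta> \<le> 1"
      "(1 - \<theta>) * average (?d k) + \<theta> * average (?d k') \<le> eps P" for k k' \<theta>
  proof -
    obtain Q where "Q \<in> ambiguity P"
      "(\<integral>\<xi>. ?f \<xi> \<partial>Q) = (1 - \<theta>) * average (\<lambda>r. ?f (k r)) + \<theta> * average (\<lambda>r. ?f (k' r))"
      using mixture_ambiguity[of k k' \<theta> x a] k by blast
    then show ?thesis unfolding worst_case_def by (metis SUP_upper)
  qed
  have sample: "sample \<in> UNIV \<rightarrow> support P" by (simp add: sample_support)
  \<comment> \<open>Leaving every sample in place is free. This gives the strictly feasible point
    for the multiplier and rules out the value minus infinity.\<close>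
  have d0: "average (?d sample) = 0" by (simp add: average_def dist1_def)
  obtain V where V: "worst_case P x a = ereal V"
  proof -
    \<comment> \<open>Any feasible completion, here with multiplier 0, bounds the worst case by a
      finite number.\<close>
    obtain y where "milp_feasible P x a y" using milp_completion[OF x a order_refl] by metis
    then have "worst_case P x a \<noteq> \<infinity>" using worst_case_le_milp by fastforce
    moreover have "worst_case P x a \<noteq> -\<infinity>"
      using mixture_le[OF sample sample, of 0] d0 eps_pos by auto
    ultimately show ?thesis using that by (cases "worst_case P x a") auto
  qed
  obtain \<rho> where \<rho>: "0 \<le> \<rho>"
    and \<rho>V: "\<And>k. k \<in> UNIV \<rightarrow> support P \<Longrightarrow>
      average (\<lambda>r. ?f (k r)) - \<rho> * (average (?d k) - eps P) \<le> V"
  proof (rule budget_multiplier[of "UNIV \<rightarrow> support P" "\<lambda>k. average (?d k)" "eps P"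
        "\<lambda>k. average (\<lambda>r. ?f (k r))" V sample])
    show "average (?d sample) < eps P" using d0 eps_pos by simp
  qed (use mixture_le sample V in auto)
  obtain y e where y: "milp_feasible P x a y" "rho y = \<rho>"
    and e: "\<And>r. r \<in> {1..nsamp P} \<Longrightarrow> block_ends (N + 2) (e r)"
    and tot: "\<And>r. r \<in> {1..nsamp P} \<Longrightarrow>
      (\<Sum>i=1..N. lin_psi y r i) + (\<Sum>j=1..N + 2. beta y r j) = penalized x a \<rho> (e r) (samp P r)"
    by (rule milp_completion[OF x a \<rho>]) blast
  have "\<forall>r. \<exists>\<xi>. \<xi> \<in> support P \<and>
      penalized x a \<rho> (e r) (sample r) = dual_value x a (e r) \<xi> - \<rho> * dist1 P \<xi> (sample r)"
    using penalized_attained[OF sample_support] by metis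
  then obtain k where k: "\<And>r. k r \<in> support P"
    and pen: "\<And>r. penalized x a \<rho> (e r) (sample r) = dual_value x a (e r) (k r) - \<rho> * ?d k r"
    by metis
  have "penalized x a \<rho> (e r) (samp P r) \<le> ?f (k r) - \<rho> * ?d k r" if r: "r \<in> {1..nsamp P}" for r
    using pen[of r] dual_value_le_second_stage[OF e[OF r], of x a "k r"] r by (simp add: sample_def)
  then have "average (\<lambda>r. penalized x a \<rho> (e r) (samp P r)) \<le> average (\<lambda>r. ?f (k r) - \<rho> * ?d k r)"
    unfolding average_def by (intro mult_left_mono sum_mono) auto
  also have "\<dots> = average (\<lambda>r. ?f (k r)) - \<rho> * average (?d k)"
    by (simp add: average_def sum_subtractf sum_distrib_left algebra_simps)
  \<comment> \<open>The multiplier inequality at the maximizers \<open>k\<close> absorbs their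
    transport cost.\<close>
  finally have "average (\<lambda>r. penalized x a \<rho> (e r) (samp P r)) + eps P * \<rho> \<le> V"
    using \<rho>V[of k] k by (simp add: algebra_simps)
  moreover have "milp_objective P y = average (\<lambda>r. penalized x a \<rho> (e r) (samp P r)) + eps P * \<rho>"
    using tot by (simp add: milp_objective_def average_def y)
  ultimately have "ereal (milp_objective P y) \<le> worst_case P x a" using V by simp
  then show ?thesis using that[OF y(1)] worst_case_le_milp[OF y(1)] by simp
qed

text \<open>For fixed \<open>(x, a)\<close> the worst case is the minimum of the program over its
  completions, and it is attained. Hence both the values and the optimal first-stage decisions
  agree.\<close>

theorem wdhras_milp:
  "wdhras_value P = milp_value P \<and>
    (\<forall>x a. wdhras_optimal P x a \<longleftrightarrow> (\<exists>y. milp_optimal P x a y))"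
proof (intro conjI allI)
  have feasible: "x \<in> assignments P" "a \<in> appointments P" if "milp_feasible P x a y" for x a y
    using that by (auto simp: milp_feasible_def)
  show "wdhras_value P = milp_value P"
  proof (rule antisym)
    show "wdhras_value P \<le> milp_value P"
      unfolding wdhras_value_def milp_value_def
      using feasible worst_case_le_milp by (intro INF_mono) fastforce
    show "milp_value P \<le> wdhras_value P"
      unfolding wdhras_value_def
    proof (rule INF_greatest)
      fix p assume "p \<in> assignments P \<times> appointments P"
      then obtain x a where p: "p = (x, a)" "x \<in> assignments P" "a \<in> appointments P" by auto
      obtain y where "milp_feasible P x a y" "ereal (milp_objective P y) = worst_case P x a"
        using strong_duality[OF p(2,3)] by blast
      then show "milp_value P \<le> (case p of (x, a) \<Rightarrow> worst_case P x a)"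
        unfolding milp_value_def p(1) by (intro INF_lower2[of "(x, a, y)"]) auto
    qed
  qed
  fix x a
  show "wdhras_optimal P x a \<longleftrightarrow> (\<exists>y. milp_optimal P x a y)"
  proof
    assume opt: "wdhras_optimal P x a"
    then obtain y where y: "milp_feasible P x a y" "ereal (milp_objective P y) = worst_case P x a"
      using strong_duality unfolding wdhras_optimal_def by metis
    have "milp_objective P y \<le> milp_objective P y'" if "milp_feasible P x' a' y'" for x' a' y'
    proof -
      have "worst_case P x a \<le> worst_case P x' a'"
        using opt feasible[OF that] by (simp add: wdhras_optimal_def)
      then show ?thesis using y(2) worst_case_le_milp[OF that] by (metis ereal_less_eq(3) order_trans)
    qed
    then show "\<exists>y. milp_optimal P x a y" using y(1) by (auto simp: milp_optimal_def)
  next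
    assume "\<exists>y. milp_optimal P x a y"
    then obtain y where y: "milp_feasible P x a y"
      and opt: "\<And>x' a' y'. milp_feasible P x' a' y' \<Longrightarrow> milp_objective P y \<le> milp_objective P y'"
      by (auto simp: milp_optimal_def)
    have "worst_case P x a \<le> worst_case P x' a'"
      if x': "x' \<in> assignments P" "a' \<in> appointments P" for x' a'
    proof -
      obtain y' where y': "milp_feasible P x' a' y'" "ereal (milp_objective P y') = worst_case P x' a'"
        using strong_duality[OF x'] by blast
      then show ?thesis using worst_case_le_milp[OF y] opt[OF y'(1)] by (metis ereal_less_eq(3) order_trans)
    qed
    then show "wdhras_optimal P x a" using feasible[OF y] by (simp add: wdhras_optimal_def)
  qed
qed

end

theorem mainTheorem2:
  fixes P :: dhras
  assumes "1 \<le> ncust P" and "0 < len P"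
    and "\<forall>j\<in>{1..ncust P}. 0 \<le> cw P j \<and> 0 \<le> cu P j" and "0 \<le> co P" and "0 \<le> lam P"
    and cost_condition: "\<forall>j\<in>{1..<ncust P}. cu P (j + 1) \<le> cu P j + cw P j"
    and "\<forall>e\<in>arcs P. 0 \<le> tlo P e" and "\<forall>i\<in>{1..ncust P}. 0 \<le> dlo P i"
    and "1 \<le> nsamp P" and "\<forall>r\<in>{1..nsamp P}. samp P r \<in> support P"
    and "0 < eps P"
  shows "wdhras_value P = milp_value P \<and>
    (\<forall>x a. wdhras_optimal P x a \<longleftrightarrow> (\<exists>y. milp_optimal P x a y))"
proof -
  interpret dhras_instance P
    using assms by unfold_locales
  show ?thesis by (rule wdhras_milp)
qed

end
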